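(* Suppose $K'\le0$ on $[0,\Phi_F]$. Suppose $Q_{\mathrm{init}}\in C^1[0,1]$ is non-decreasing, $Q_{\mathrm{init}}(0)=0$, $Q_{\mathrm{init}}(1)=\Phi_F$, $$\frac{d}{d\eta}Q_{\mathrm{init}}(1)>K(\Phi_F),\qquad \frac{d}{d\eta}Q_{\mathrm{init}}(1)-\frac{d}{d\eta}Q_{\mathrm{init}}(0)=K(\Phi_F)-K(0),$$ and that the function $$H_{\mathrm{init}}(\eta):=\frac{d}{d\eta}Q_{\mathrm{init}}(\eta)-K(Q_{\mathrm{init}}(\eta)),\qquad \eta\in[0,1],$$ satisfies $H_{\mathrm{init}}(\eta)>0$ for all $\eta\in[0,1]$. Then there exists a unique global classical solution $(Q,N)$ (i.e. on $[0,+\infty)$) of system (S) with initial datum $Q_{\mathrm{init}}$. Moreover, $$0<\frac1{\max_{\eta\in[0,1]}H_{\mathrm{init}}(\eta)}\le N(\tau)\le\frac1{\min_{\eta\in[0,1]}H_{\mathrm{init}}(\eta)}<+\infty,\qquad \tau\ge0 .$$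
   Context: Standing assumptions: $\Phi_F>0$ is fixed and $K\in C^2(\mathbb{R})$ is a function with $K',K''$ bounded on $\mathbb{R}$ and $K(\phi)>0$ for $\phi\in[0,\Phi_F]$. System (S), for unknowns $Q(\tau,\eta)$ and $N(\tau)$: $$\partial_\tau Q+\partial_\eta Q=\frac1{N(\tau)}+K(Q)\quad(\tau>0,\ \eta\in(0,1)),\qquad Q(\tau,0)=0\quad(\tau>0),$$ $$\frac1{N(\tau)}=\partial_\eta Q(\tau,1)-K(\Phi_F)\quad(\tau>0),\qquad Q(0,\eta)=Q_{\mathrm{init}}(\eta)\quad(\eta\in[0,1]).$$ Classical solution: given $0<T\le+\infty$ and an initial datum $Q_{\mathrm{init}}\in C^1[0,1]$ that is increasing with $Q_{\mathrm{init}}(0)=0$, $Q_{\mathrm{init}}(1)=\Phi_F$ and $\frac{d}{d\eta}Q_{\mathrm{init}}(1)>K(\Phi_F)$, a pair $(Q,N)$ is a classical solution of (S) on $[0,T)$ if (1) $Q\in C^1([0,T)\times[0,1])$ is increasing in $\eta$ and $N\in C[0,T)$ is positive; (2) the equations of (S) hold in the classical sense for $\tau\in[0,T)$; (3) $K(\Phi_F)<\partial_\eta Q(\tau,1)<+\infty$ for all $\tau\in[0,T)$. Here "increasing" means non-decreasing. *)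

theory Defs
  imports "HOL-Analysis.Analysis"
begin

text \<open>\<open>Q \<in> C\<^sup>1(I \<times> J)\<close> with partial derivatives \<open>Qt\<close> (first argument) and \<open>Qx\<close> (second argument);
  at end points of \<open>I\<close> and \<open>J\<close> that belong to the interval, the derivatives are one-sided.\<close>
definition C1_with_partials ::
  "real set \<Rightarrow> real set \<Rightarrow> (real \<Rightarrow> real \<Rightarrow> real) \<Rightarrow> (real \<Rightarrow> real \<Rightarrow> real) \<Rightarrow> (real \<Rightarrow> real \<Rightarrow> real) \<Rightarrow> bool"
  where
  "C1_with_partials I J Q Qt Qx \<longleftrightarrow>
     (\<forall>t\<in>I. \<forall>x\<in>J.
        ((\<lambda>s. Q s x) has_real_derivative Qt t x) (at t within I) \<and>
        ((\<lambda>y. Q t y) has_real_derivative Qx t x) (at x within J)) \<and>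
     continuous_on (I \<times> J) (\<lambda>(t, x). Q t x) \<and>
     continuous_on (I \<times> J) (\<lambda>(t, x). Qt t x) \<and>
     continuous_on (I \<times> J) (\<lambda>(t, x). Qx t x)"

definition time_interval :: "ereal \<Rightarrow> real set" where
  "time_interval T = {\<tau>. 0 \<le> \<tau> \<and> ereal \<tau> < T}"

text \<open>The equations for \<open>\<tau> > 0\<close> are imposed on \<open>0 < \<tau> < T\<close>; for classical solutions they extend
  to \<open>\<tau> = 0\<close> (and the transport equation to \<open>\<eta> \<in> {0, 1}\<close>) by continuity.\<close>
definition system_S ::
  "(real \<Rightarrow> real) \<Rightarrow> real \<Rightarrow> (real \<Rightarrow> real) \<Rightarrow> ereal \<Rightarrow>
   (real \<Rightarrow> real \<Rightarrow> real) \<Rightarrow> (real \<Rightarrow> real \<Rightarrow> real) \<Rightarrow> (real \<Rightarrow> real \<Rightarrow> real) \<Rightarrow> (real \<Rightarrow> real) \<Rightarrow> bool"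
  where
  "system_S K \<Phi>\<^sub>F Q\<^sub>i T Q Qt Qx N \<longleftrightarrow>
     (\<forall>\<tau>>0. ereal \<tau> < T \<longrightarrow>
        (\<forall>\<eta>\<in>{0<..<1}. Qt \<tau> \<eta> + Qx \<tau> \<eta> = 1 / N \<tau> + K (Q \<tau> \<eta>)) \<and>
        Q \<tau> 0 = 0 \<and>
        1 / N \<tau> = Qx \<tau> 1 - K \<Phi>\<^sub>F) \<and>
     (\<forall>\<eta>\<in>{0..1}. Q 0 \<eta> = Q\<^sub>i \<eta>)"

text \<open>The upper bound \<open>Qx \<tau> 1 < +\<infinity>\<close> is implicit, since \<open>Qx\<close> is real-valued.\<close>
definition classical_solution ::
  "(real \<Rightarrow> real) \<Rightarrow> real \<Rightarrow> (real \<Rightarrow> real) \<Rightarrow> ereal \<Rightarrow> (real \<Rightarrow> real \<Rightarrow> real) \<Rightarrow> (real \<Rightarrow> real) \<Rightarrow> bool"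
  where
  "classical_solution K \<Phi>\<^sub>F Q\<^sub>i T Q N \<longleftrightarrow>
     (\<exists>Qt Qx.
        C1_with_partials (time_interval T) {0..1} Q Qt Qx \<and>
        (\<forall>\<tau>\<in>time_interval T. mono_on {0..1} (Q \<tau>)) \<and>
        continuous_on (time_interval T) N \<and>
        (\<forall>\<tau>\<in>time_interval T. N \<tau> > 0) \<and>
        system_S K \<Phi>\<^sub>F Q\<^sub>i T Q Qt Qx N \<and>
        (\<forall>\<tau>\<in>time_interval T. K \<Phi>\<^sub>F < Qx \<tau> 1))"

definition H_init :: "(real \<Rightarrow> real) \<Rightarrow> (real \<Rightarrow> real) \<Rightarrow> (real \<Rightarrow> real) \<Rightarrow> real \<Rightarrow> real" where
  "H_init K Q\<^sub>i Q\<^sub>i' \<eta> = Q\<^sub>i' \<eta> - K (Q\<^sub>i \<eta>)"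

end

theory Submission
  imports Defs
begin

text \<open>
Write \<open>h = 1/N\<close> and \<open>H = \<partial>\<^sub>\<eta>Q - K(Q)\<close>. The boundary condition at \<open>\<eta> = 1\<close> forces \<open>Q(\<tau>,1) = \<Phi>\<close>,
because \<open>z = Q(\<tau>,1)\<close> solves \<open>z' = K(z) - K(\<Phi>)\<close>; together with \<open>Q(\<tau>,0) = 0\<close> it gives
\<open>H(\<tau>,0) = H(\<tau>,1) = h(\<tau>)\<close>. Along a characteristic \<open>\<tau> - \<eta> = const\<close> one has
\<open>Q' = h + K(Q)\<close> and \<open>H' = K'(Q) (H - h)\<close>. So \<open>H\<close> is transported periodically, and since \<open>K' \<le> 0\<close>
it is relaxed towards the trace \<open>h\<close> of \<open>H\<close> itself: \<open>H\<close> never leaves the interval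
\<open>[min H\<^sub>i\<^sub>n\<^sub>i\<^sub>t, max H\<^sub>i\<^sub>n\<^sub>i\<^sub>t]\<close>. This keeps \<open>N\<close> positive and bounded, hence the solution global, and it is the
bound on \<open>N\<close>.

Existence. A characteristic is labelled by \<open>s = \<tau> - \<eta> \<ge> -1\<close>; it enters the strip at time \<open>max 0 s\<close> and
leaves it at time \<open>s + 1\<close>. In the coordinates \<open>(s, t)\<close> the two ordinary differential equations and
\<open>h(\<tau>) = H(\<tau> - 1, \<tau>)\<close> form a closed system of integral equations with delay. After
\<open>K'\<close> has been frozen outside \<open>[0,\<Phi>]\<close> and the values of \<open>H\<close> and \<open>h\<close> have been clipped to the
interval that the a priori bound predicts, all the nonlinearities are globally Lipschitz, and a weight
\<open>exp (\<gamma> (s + t))\<close> makes the system a contraction on the whole unbounded strip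
(\<open>fixed_point_exists\<close>), so that a global solution is obtained at once. The a priori bound then removes the clipping (\<open>h_range\<close>).

The integral equations say nothing about \<open>\<partial>\<^sub>\<eta>Q\<close>. The key observation is that the
difference of \<open>Q\<close> along two characteristics solves a linear scalar equation, whose explicit solution can be
divided by the distance of the labels; in the limit \<open>\<partial>\<^sub>\<eta>Q\<close> exists, and it solves the same linear equation as \<open>H + K(Q)\<close>
(\<open>y_label_deriv_past\<close>, \<open>y_label_deriv_future\<close>, \<open>P_solution\<close>). The formula also gives \<open>\<partial>\<^sub>\<eta>Q > 0\<close>, and with \<open>Q(\<tau>,1) = \<Phi>\<close>
this shows that \<open>Q\<close> takes its values in \<open>[0,\<Phi>]\<close>, where \<open>K\<close> has not been changed.

Uniqueness. For two solutions let \<open>g\<close> be the primitive of \<open>h\<^sub>1 - h\<^sub>2\<close>. On a characteristic that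
starts with equal data, \<open>Q\<^sub>1 - Q\<^sub>2 - g\<close> is bounded by the integral of \<open>\<bar>g\<bar>\<close>; at its
end \<open>Q\<^sub>1 = Q\<^sub>2 = \<Phi>\<close>, so \<open>\<bar>g\<bar>\<close> is bounded by its own integral and Gronwall's lemma gives \<open>g = 0\<close>
(\<open>firing_characteristics_unique\<close>). Working with \<open>g\<close> rather than \<open>h\<^sub>1 - h\<^sub>2\<close> keeps all
derivatives of \<open>Q\<close> out of the estimate.
\<close>

section \<open>Averages over segments\<close>

text \<open>Times \<open>b - a\<close>, this is the oriented integral of \<open>f\<close> from \<open>a\<close> to \<open>b\<close>. Since the domain of integration is fixed,
continuity in \<open>a\<close>, \<open>b\<close> and any further parameter is immediate, also across \<open>a = b\<close>, where the average is
\<open>f a\<close>. Integrals with variable limits and difference quotients are therefore both expressed by averages.\<close>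

definition avg :: "(real \<Rightarrow> real) \<Rightarrow> real \<Rightarrow> real \<Rightarrow> real" where
  "avg f a b = integral {0..1} (\<lambda>\<theta>. f (a + \<theta> * (b - a)))"

lemma continuous_on_avg:
  fixes f :: "'a::topological_space \<Rightarrow> real \<Rightarrow> real"
  assumes f: "continuous_on UNIV (\<lambda>(x, \<sigma>). f x \<sigma>)"
    and a: "continuous_on UNIV a" and b: "continuous_on UNIV b"
  shows "continuous_on UNIV (\<lambda>x. avg (f x) (a x) (b x))"
proof -
  have "continuous_on (UNIV \<times> cbox 0 1) (\<lambda>p. (\<lambda>(x, \<sigma>). f x \<sigma>) (fst p, a (fst p) + snd p * (b (fst p) - a (fst p))))"
  proof (rule continuous_on_compose2[OF f])
    have "continuous_on (UNIV \<times> cbox 0 (1::real)) (\<lambda>p. a (fst p))"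
      "continuous_on (UNIV \<times> cbox 0 (1::real)) (\<lambda>p. b (fst p))"
      by (rule continuous_on_compose2[OF a continuous_on_fst[OF continuous_on_id]], simp)
         (rule continuous_on_compose2[OF b continuous_on_fst[OF continuous_on_id]], simp)
    then show "continuous_on (UNIV \<times> cbox 0 (1::real)) (\<lambda>p. (fst p, a (fst p) + snd p * (b (fst p) - a (fst p))))"
      by (intro continuous_intros)
  qed simp
  then have "continuous_on (UNIV \<times> cbox 0 1) (\<lambda>(x, \<theta>). f x (a x + \<theta> * (b x - a x)))"
    by (simp add: case_prod_beta)
  from integral_continuous_on_param[OF this] show ?thesis
    by (simp add: avg_def)
qed

lemma continuous_on_avg_endpoints:
  assumes k: "continuous_on UNIV k" and f: "continuous_on S f" and g: "continuous_on S g"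
  shows "continuous_on S (\<lambda>x. avg k (f x) (g x))"
proof -
  have "continuous_on UNIV (\<lambda>p. avg k (fst p) (snd p))"
    by (rule continuous_on_avg)
       (auto intro!: continuous_intros continuous_on_compose2[OF k] simp: case_prod_beta)
  from continuous_on_compose2[OF this continuous_on_Pair[OF f g]] show ?thesis by simp
qed

lemma avg_point: "avg f a a = f a"
  by (simp add: avg_def)

lemma avg_bound:
  assumes f: "continuous_on UNIV f" and le: "\<And>x. \<bar>f x\<bar> \<le> C"
  shows "\<bar>avg f a b\<bar> \<le> C"
proof -
  have "norm (integral {0..1} (\<lambda>\<theta>. f (a + \<theta> * (b - a)))) \<le> C * (1 - 0)"
  proof (rule integral_bound)
    show "continuous_on {0..1} (\<lambda>\<theta>. f (a + \<theta> * (b - a)))"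
      by (rule continuous_on_compose2[OF f]) (auto intro!: continuous_intros)
  qed (use le in auto)
  then show ?thesis by (simp add: avg_def)
qed

lemma affine_in_segment:
  fixes a b \<theta> :: real
  assumes "\<theta> \<in> {0..1}"
  shows "a + \<theta> * (b - a) \<in> closed_segment a b"
proof -
  have "a + \<theta> * (b - a) = (1 - \<theta>) *\<^sub>R a + \<theta> *\<^sub>R b" by (simp add: algebra_simps)
  then show ?thesis unfolding in_segment using assms by (intro exI[of _ \<theta>]) auto
qed

text \<open>With \<open>F = K\<close>, \<open>f = K'\<close> this factors \<open>K b - K a\<close> as \<open>b - a\<close> times a function continuous in both end
points, which turns differences of solutions into solutions of linear equations.\<close>

lemma avg_FTC:
  assumes "\<And>x. x \<in> closed_segment a b \<Longrightarrow> (F has_real_derivative f x) (at x within closed_segment a b)"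
  shows "(b - a) * avg f a b = F b - F a"
proof -
  let ?p = "\<lambda>\<theta>. a + \<theta> * (b - a)"
  have "((\<lambda>\<theta>. F (?p \<theta>)) has_real_derivative f (?p \<theta>) * (b - a)) (at \<theta> within {0..1})"
    if "\<theta> \<in> {0..1}" for \<theta>
  proof (rule DERIV_image_chain[where g = ?p, unfolded o_def])
    have "?p ` {0..1} \<subseteq> closed_segment a b" using affine_in_segment by blast
    then show "(F has_real_derivative f (?p \<theta>)) (at (?p \<theta>) within ?p ` {0..1})"
      by (rule DERIV_subset[OF assms[OF affine_in_segment[OF that]]])
    show "(?p has_real_derivative b - a) (at \<theta> within {0..1})"
      by (auto intro!: derivative_eq_intros)
  qed
  then have "((\<lambda>\<theta>. f (?p \<theta>) * (b - a)) has_integral F (?p 1) - F (?p 0)) {0..1}"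
    by (intro fundamental_theorem_of_calculus)
       (auto simp: has_real_derivative_iff_has_vector_derivative)
  then have "integral {0..1} (\<lambda>\<theta>. f (?p \<theta>) * (b - a)) = F b - F a"
    by (auto dest: integral_unique simp del: integral_mult_left)
  then show ?thesis unfolding avg_def
    by (simp add: mult.commute)
qed

lemma avg_eq_integral:
  assumes "continuous_on {a..b} f" "a \<le> b"
  shows "(b - a) * avg f a b = integral {a..b} f"
proof -
  have "(b - a) * avg f a b = integral {a..b} f - integral {a..a} f"
    by (rule avg_FTC)
       (use assms integral_has_real_derivative[OF assms(1)] in \<open>auto simp: closed_segment_eq_real_ivl\<close>)
  then show ?thesis by simp
qed

lemma avg_antiderivative:
  assumes f: "continuous_on UNIV f" and "r < t"
  shows "((\<lambda>t. (t - r) * avg f r t) has_real_derivative f t) (at t)"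
proof -
  have f': "continuous_on S f" for S using f continuous_on_subset by blast
  have "((\<lambda>t. integral {r..t} f) has_real_derivative f t) (at t within {r..t + 1})"
    using \<open>r < t\<close> by (intro integral_has_real_derivative f') auto
  then have "((\<lambda>t. integral {r..t} f) has_real_derivative f t) (at t)"
    using \<open>r < t\<close> by (simp add: at_within_Icc_at)
  then show ?thesis
  proof (rule has_field_derivative_transform_within_open[of _ _ _ "{r<..}"])
    show "integral {r..x} f = (x - r) * avg f r x" if "x \<in> {r<..}" for x
      using that by (intro avg_eq_integral[symmetric] f') auto
  qed (use \<open>r < t\<close> in auto)
qed

text \<open>Differentiability without limits: it suffices to factor the increments of \<open>f\<close> with a jointly continuous factor.
The factorisation is required for \<open>x \<le> y\<close> only, because for characteristics the larger label decides from what
time on two of them coexist.\<close>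

lemma derivative_from_quotient:
  fixes f :: "real \<Rightarrow> real" and E :: "real \<Rightarrow> real \<Rightarrow> real"
  assumes E: "continuous_on UNIV (\<lambda>(x, y). E x y)" and U: "open U" "s \<in> U"
    and eq: "\<And>x y. x \<in> U \<Longrightarrow> y \<in> U \<Longrightarrow> x \<le> y \<Longrightarrow> f x - f y = (y - x) * E x y"
  shows "(f has_real_derivative - E s s) (at s)"
proof -
  have "isCont (\<lambda>y. - E (min s y) (max s y)) s"
    using continuous_on_compose2[OF E, of UNIV "\<lambda>y. (min s y, max s y)"]
    by (intro continuous_minus) (simp add: continuous_on_eq_continuous_at continuous_intros)
  then have "((\<lambda>y. - E (min s y) (max s y)) \<longlongrightarrow> - E s s) (at s)"
    by (simp add: isCont_def)
  moreover have "\<forall>\<^sub>F y in at s. (f y - f s) / (y - s) = - E (min s y) (max s y)"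
    unfolding eventually_at_topological
  proof (intro exI[of _ U] conjI ballI impI)
    fix y assume "y \<in> U" "y \<noteq> s"
    then show "(f y - f s) / (y - s) = - E (min s y) (max s y)"
      using eq[of s y] eq[of y s] U(2) by (cases "s \<le> y") (auto simp: field_simps min_def max_def)
  qed (use U in auto)
  ultimately show ?thesis
    unfolding has_field_derivative_iff by (simp add: tendsto_cong)
qed

section \<open>Scalar differential equations and a chain rule\<close>

lemma integral_step:
  fixes f :: "real \<Rightarrow> real"
  assumes "continuous_on {a..b} f" "a \<le> b" and "\<And>x. x \<in> {a<..<b} \<Longrightarrow> (f has_real_derivative f' x) (at x)"
  shows "(f' has_integral f b - f a) {a..b}"
  using assms by (intro fundamental_theorem_of_calculus_interior)
    (auto simp: has_real_derivative_iff_has_vector_derivative)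

lemma linear_ODE_solution:
  fixes d \<kappa> :: "real \<Rightarrow> real"
  assumes \<kappa>: "continuous_on {a..b} \<kappa>" and d: "continuous_on {a..b} d" and ab: "a \<le> b"
    and deriv: "\<And>t. a < t \<Longrightarrow> t < b \<Longrightarrow> (d has_real_derivative \<kappa> t * d t) (at t)"
  shows "d b = d a * exp ((b - a) * avg \<kappa> a b)"
proof -
  let ?A = "\<lambda>t. integral {a..t} \<kappa>"
  have contA: "continuous_on {a..b} ?A"
    using integral_has_real_derivative[OF \<kappa>] by (meson DERIV_continuous_on)
  have derA: "(?A has_real_derivative \<kappa> t) (at t)" if "a < t" "t < b" for t
    using integral_has_real_derivative[OF \<kappa>, of t] that by (simp add: at_within_Icc_at)
  have "((\<lambda>_. 0) has_integral d b * exp (- ?A b) - d a * exp (- ?A a)) {a..b}"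
  proof (rule integral_step[where f = "\<lambda>t. d t * exp (- ?A t)"])
    show "continuous_on {a..b} (\<lambda>t. d t * exp (- ?A t))"
      by (intro continuous_intros d contA)
    show "((\<lambda>t. d t * exp (- ?A t)) has_real_derivative 0) (at t)" if "t \<in> {a<..<b}" for t
      using that by (auto intro!: derivative_eq_intros deriv derA simp: algebra_simps)
  qed fact
  then have "d b * exp (- ?A b) = d a"
    by (simp add: has_integral_0_eq)
  then have "d b = d a * exp (?A b)" by (simp add: exp_minus field_simps)
  then show ?thesis by (simp add: avg_eq_integral[OF \<kappa> ab])
qed

text \<open>The integrating factor \<open>exp (- \<integral>\<kappa>)\<close> leaves \<open>\<kappa> g\<close> as the only source.\<close>

lemma perturbed_linear_ODE_bound:
  fixes d \<kappa> g :: "real \<Rightarrow> real"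
  assumes \<kappa>: "continuous_on {a..b} \<kappa>" and d: "continuous_on {a..b} d" and g: "continuous_on {a..b} g"
    and ab: "a \<le> b" "b \<le> a + 1"
    and deriv: "\<And>t. a < t \<Longrightarrow> t < b \<Longrightarrow> (d has_real_derivative \<kappa> t * (d t + g t)) (at t)"
    and start: "d a = 0" and \<kappa>_le: "\<And>t. \<bar>\<kappa> t\<bar> \<le> L"
  shows "\<bar>d b\<bar> \<le> L * exp (2 * L) * integral {a..b} (\<lambda>t. \<bar>g t\<bar>)"
proof -
  let ?A = "\<lambda>t. integral {a..t} \<kappa>"
  have L: "0 \<le> L" using \<kappa>_le[of 0] by linarith
  have contA: "continuous_on {a..b} ?A"
    using integral_has_real_derivative[OF \<kappa>] by (meson DERIV_continuous_on)
  have derA: "(?A has_real_derivative \<kappa> t) (at t)" if "a < t" "t < b" for t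
    using integral_has_real_derivative[OF \<kappa>, of t] that by (simp add: at_within_Icc_at)
  have A_le: "\<bar>?A t\<bar> \<le> L" if "t \<in> {a..b}" for t
  proof -
    have "norm (?A t) \<le> L * (t - a)"
      by (rule integral_bound) (use that \<kappa>_le continuous_on_subset[OF \<kappa>] in auto)
    also have "\<dots> \<le> L * 1" using that ab L by (intro mult_left_mono) auto
    finally show ?thesis by simp
  qed
  have "((\<lambda>t. \<kappa> t * g t * exp (- ?A t)) has_integral d b * exp (- ?A b) - d a * exp (- ?A a)) {a..b}"
  proof (rule integral_step[where f = "\<lambda>t. d t * exp (- ?A t)"])
    show "continuous_on {a..b} (\<lambda>t. d t * exp (- ?A t))"
      by (intro continuous_intros d contA)
    show "((\<lambda>t. d t * exp (- ?A t)) has_real_derivative \<kappa> t * g t * exp (- ?A t)) (at t)" if "t \<in> {a<..<b}" for t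
      using that by (auto intro!: derivative_eq_intros deriv derA simp: algebra_simps)
  qed fact
  then have int: "d b * exp (- ?A b) = integral {a..b} (\<lambda>t. \<kappa> t * g t * exp (- ?A t))"
    by (simp add: start integral_unique)
  have "norm (integral {a..b} (\<lambda>t. \<kappa> t * g t * exp (- ?A t))) \<le> integral {a..b} (\<lambda>t. (L * exp L) * \<bar>g t\<bar>)"
  proof (rule integral_norm_bound_integral)
    show "(\<lambda>t. \<kappa> t * g t * exp (- ?A t)) integrable_on {a..b}"
      by (intro integrable_continuous_real continuous_intros \<kappa> g contA)
    show "(\<lambda>t. (L * exp L) * \<bar>g t\<bar>) integrable_on {a..b}"
      by (intro integrable_continuous_real continuous_intros g)
    show "norm (\<kappa> t * g t * exp (- ?A t)) \<le> (L * exp L) * \<bar>g t\<bar>" if "t \<in> {a..b}" for t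
    proof -
      have "\<bar>\<kappa> t\<bar> * exp (- ?A t) \<le> L * exp L"
        using A_le[OF that] \<kappa>_le L by (intro mult_mono) auto
      from mult_right_mono[OF this, of "\<bar>g t\<bar>"] show ?thesis
        by (simp add: abs_mult mult_ac)
    qed
  qed
  then have "\<bar>d b\<bar> * exp (- ?A b) \<le> (L * exp L) * integral {a..b} (\<lambda>t. \<bar>g t\<bar>)"
    unfolding int[symmetric] by (simp add: abs_mult)
  then have "\<bar>d b\<bar> \<le> exp (?A b) * ((L * exp L) * integral {a..b} (\<lambda>t. \<bar>g t\<bar>))"
    by (simp add: exp_minus field_simps)
  also have "\<dots> \<le> exp L * ((L * exp L) * integral {a..b} (\<lambda>t. \<bar>g t\<bar>))"
  proof (rule mult_right_mono)
    show "exp (?A b) \<le> exp L" using A_le[of b] ab by simp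
    show "0 \<le> (L * exp L) * integral {a..b} (\<lambda>t. \<bar>g t\<bar>)"
      using L by (intro mult_nonneg_nonneg integral_nonneg integrable_continuous_real continuous_intros g) auto
  qed
  also have "\<dots> = L * exp (2 * L) * integral {a..b} (\<lambda>t. \<bar>g t\<bar>)"
    by (simp add: exp_double power2_eq_square)
  finally show ?thesis .
qed

text \<open>A function that does not increase while it is above \<open>M\<close> cannot get above \<open>M\<close>: after the last time with value at most \<open>M\<close>
the mean value theorem would give an increase with a nonpositive slope.\<close>

lemma barrier:
  fixes f :: "real \<Rightarrow> real"
  assumes f: "continuous_on {a..b} f" and ab: "a \<le> b" and start: "f a \<le> M"
    and deriv: "\<And>t. a < t \<Longrightarrow> t < b \<Longrightarrow> (f has_real_derivative f' t) (at t)"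
    and decr: "\<And>t. a < t \<Longrightarrow> t < b \<Longrightarrow> f t > M \<Longrightarrow> f' t \<le> 0"
  shows "f b \<le> M"
proof (rule ccontr)
  assume "\<not> f b \<le> M"
  define S where "S = {t \<in> {a..b}. f t \<le> M}"
  have "closed S" unfolding S_def
    using continuous_closed_preimage[OF f, of "{..M}"] by (simp add: vimage_def Int_def)
  then have "compact S" using bounded_subset[of "{a..b}" S] compact_eq_bounded_closed S_def by blast
  moreover have "a \<in> S" using ab start by (simp add: S_def)
  ultimately obtain c where c: "c \<in> S" "\<And>t. t \<in> S \<Longrightarrow> t \<le> c"
    using compact_attains_sup[of S] by blast
  have cb: "c < b" using c(1) \<open>\<not> f b \<le> M\<close> unfolding S_def by (cases "c = b") auto
  have "a \<le> c" using c(1) by (simp add: S_def)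
  have "continuous_on {c..b} f" using f \<open>a \<le> c\<close> by (elim continuous_on_subset) auto
  moreover have "(f has_derivative (*) (f' t)) (at t)" if "c < t" "t < b" for t
    using deriv[of t] that \<open>a \<le> c\<close> by (simp add: has_field_derivative_def)
  ultimately obtain \<xi> where \<xi>: "c < \<xi>" "\<xi> < b" "f b - f c = f' \<xi> * (b - c)"
    using mvt[OF cb, of f "\<lambda>t. (*) (f' t)"] by metis
  have "f \<xi> > M" using c(2)[of \<xi>] \<xi> \<open>a \<le> c\<close> by (force simp: S_def)
  then have "f' \<xi> \<le> 0" using decr \<xi> \<open>a \<le> c\<close> by auto
  then have "f b \<le> f c" using \<xi>(3) cb mult_nonpos_nonneg[of "f' \<xi>" "b - c"] by simp
  then show False using c(1) \<open>\<not> f b \<le> M\<close> by (simp add: S_def)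
qed

text \<open>The primitive \<open>U\<close> of \<open>u\<close> satisfies \<open>U' \<le> C U\<close>, so \<open>U(t) exp (- C t)\<close> stays below its initial value 0.\<close>

lemma Gronwall_zero:
  fixes u :: "real \<Rightarrow> real"
  assumes u: "continuous_on {a..b} u" and nn: "\<And>t. t \<in> {a..b} \<Longrightarrow> u t \<ge> 0"
    and le: "\<And>t. t \<in> {a..b} \<Longrightarrow> u t \<le> C * integral {a..t} u" and t: "t \<in> {a..b}"
  shows "u t = 0"
proof -
  let ?U = "\<lambda>t. integral {a..t} u"
  have contU: "continuous_on {a..b} ?U"
    using integral_has_real_derivative[OF u] by (meson DERIV_continuous_on)
  have derU: "(?U has_real_derivative u t) (at t)" if "a < t" "t < b" for t
    using integral_has_real_derivative[OF u, of t] that by (simp add: at_within_Icc_at)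
  have "?U t * exp (- C * t) \<le> 0"
  proof (rule barrier[where f = "\<lambda>t. ?U t * exp (- C * t)" and a = a and b = t])
    show "continuous_on {a..t} (\<lambda>t. ?U t * exp (- C * t))"
      using t by (intro continuous_intros continuous_on_subset[OF contU]) auto
    show "((\<lambda>t. ?U t * exp (- C * t)) has_real_derivative (u s - C * ?U s) * exp (- C * s)) (at s)"
      if "a < s" "s < t" for s
      using that t by (auto intro!: derivative_eq_intros derU simp: algebra_simps)
    show "(u s - C * ?U s) * exp (- C * s) \<le> 0" if "a < s" "s < t" for s
      using le[of s] that t by (simp add: mult_le_0_iff)
  qed (use t in auto)
  then have "?U t \<le> 0" by (simp add: mult_le_0_iff)
  moreover have "?U t \<ge> 0"
    using t by (intro integral_nonneg integrable_continuous_real continuous_on_subset[OF u] nn) auto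
  ultimately have "?U t = 0" by simp
  then show ?thesis using le[OF t] nn[OF t] by simp
qed

text \<open>Only one of the two partial derivatives has to be continuous. This allows the chain rule to be applied in
characteristic coordinates as well as in the original ones.\<close>

lemma chain_rule_two_variables:
  fixes f fa fb :: "real \<Rightarrow> real \<Rightarrow> real"
  assumes open_XY: "open X" "open Y" "convex Y" and pq: "p t \<in> X" "q t \<in> Y"
    and fa: "((\<lambda>x. f x (q t)) has_real_derivative fa (p t) (q t)) (at (p t))"
    and fb: "\<And>x y. x \<in> X \<Longrightarrow> y \<in> Y \<Longrightarrow> ((\<lambda>y. f x y) has_real_derivative fb x y) (at y)"
    and cont: "continuous_on (X \<times> Y) (\<lambda>(x, y). fb x y)"
    and p: "(p has_real_derivative p') (at t)" and q: "(q has_real_derivative q') (at t)"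
  shows "((\<lambda>s. f (p s) (q s)) has_real_derivative fa (p t) (q t) * p' + fb (p t) (q t) * q') (at t)"
proof -
  have "((\<lambda>(x, y). f x y) has_derivative
      (\<lambda>(tx, ty). fa (p t) (q t) * tx + blinfun_apply (blinfun_mult_right (fb (p t) (q t))) ty))
      (at (p t, q t) within X \<times> Y)"
  proof (rule has_derivative_partialsI)
    show "((\<lambda>x. f x (q t)) has_derivative (*) (fa (p t) (q t))) (at (p t) within X)"
      using fa by (simp add: has_field_derivative_def has_derivative_at_withinI)
    show "((\<lambda>y. f x y) has_derivative blinfun_apply (blinfun_mult_right (fb x y))) (at y within Y)"
      if "x \<in> X" "y \<in> Y" for x y
      using fb[OF that] by (simp add: has_field_derivative_def has_derivative_at_withinI)
    have "continuous_on (X \<times> Y) (\<lambda>z. blinfun_mult_right ((\<lambda>(x, y). fb x y) z))"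
      by (rule bounded_linear.continuous_on[OF bounded_linear_blinfun_mult_right cont])
    then show "continuous (at (p t, q t) within X \<times> Y) (\<lambda>(x, y). blinfun_mult_right (fb x y))"
      using pq by (simp add: continuous_on_eq_continuous_within case_prod_unfold)
  qed (use pq open_XY in auto)
  then have "((\<lambda>(x, y). f x y) has_derivative (\<lambda>(tx, ty). fa (p t) (q t) * tx + fb (p t) (q t) * ty)) (at (p t, q t))"
    using pq open_XY by (simp add: at_within_open[OF _ open_Times])
  moreover have "((\<lambda>s. (p s, q s)) has_derivative (\<lambda>x. (p' * x, q' * x))) (at t)"
    using p q by (intro has_derivative_Pair) (auto simp: has_field_derivative_def)
  ultimately have "((\<lambda>s. (\<lambda>(x, y). f x y) (p s, q s)) has_derivative
      (\<lambda>x. (\<lambda>(tx, ty). fa (p t) (q t) * tx + fb (p t) (q t) * ty) (p' * x, q' * x))) (at t)"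
    by (rule has_derivative_compose[rotated])
  moreover have "(\<lambda>x. (\<lambda>(tx, ty). fa (p t) (q t) * tx + fb (p t) (q t) * ty) (p' * x, q' * x)) =
      (*) (fa (p t) (q t) * p' + fb (p t) (q t) * q')"
    by (auto simp: algebra_simps)
  ultimately show ?thesis by (simp add: has_field_derivative_def)
qed

lemma zero_on_closed_unit_interval:
  fixes f :: "real \<Rightarrow> real"
  assumes "continuous_on {0..1} f" "\<And>x. 0 < x \<Longrightarrow> x < 1 \<Longrightarrow> f x = 0" "x \<in> {0..1}"
  shows "f x = 0"
  by (rule continuous_constant_on_closure[of "{0<..<1}" f]) (use assms in auto)

section \<open>A fixed point theorem in a weighted norm\<close>

text \<open>Banach's theorem for the norm \<open>sup \<parallel>u x\<parallel> / w x\<close>, transported to the complete space of bounded continuous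
functions by \<open>u \<mapsto> u / w\<close>. The Lipschitz condition is stated pointwise, for every bound \<open>B\<close> on the
weighted distance.\<close>

lemma weighted_fixed_point:
  fixes T :: "('a::metric_space \<Rightarrow> 'b::banach) \<Rightarrow> 'a \<Rightarrow> 'b" and w :: "'a \<Rightarrow> real"
  assumes w: "continuous_on UNIV w" "\<And>x. w x > 0"
    and cont: "\<And>u. continuous_on UNIV u \<Longrightarrow> continuous_on UNIV (T u)"
    and base: "\<And>x. norm (T (\<lambda>_. 0) x) \<le> B * w x"
    and contr: "\<And>u v B x. continuous_on UNIV u \<Longrightarrow> continuous_on UNIV v \<Longrightarrow>
        (\<And>x. norm (u x - v x) \<le> B * w x) \<Longrightarrow> norm (T u x - T v x) \<le> c * B * w x"
    and c: "0 \<le> c" "c < 1"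
  shows "\<exists>u. continuous_on UNIV u \<and> T u = u"
proof -
  define up where "up g x = w x *\<^sub>R apply_bcontfun g x" for g :: "'a \<Rightarrow>\<^sub>C 'b" and x
  have cup: "continuous_on UNIV (up g)" for g
    unfolding up_def by (intro continuous_intros w) auto
  define S where "S g x = T (up g) x /\<^sub>R w x" for g x
  have diff: "norm (S g x - S g' x) \<le> c * dist g g'" for g g' x
  proof -
    have "norm (T (up g) x - T (up g') x) \<le> c * dist g g' * w x"
    proof (rule contr[OF cup cup])
      fix x
      have "norm (up g x - up g' x) = w x * dist (apply_bcontfun g x) (apply_bcontfun g' x)"
        using w(2)[of x] by (simp add: up_def dist_norm flip: scaleR_diff_right)
      also have "\<dots> \<le> w x * dist g g'"
        using w(2)[of x] dist_bounded by (intro mult_left_mono) auto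
      finally show "norm (up g x - up g' x) \<le> dist g g' * w x" by (simp add: mult.commute)
    qed
    then show ?thesis using w(2)[of x]
      by (simp add: S_def divide_simps flip: scaleR_diff_right)
  qed
  have bcf: "S g \<in> bcontfun" for g
  proof (rule bcontfun_normI)
    show "continuous_on UNIV (S g)" unfolding S_def
      using w(2) by (intro continuous_intros cont[OF cup] w(1)) (metis less_irrefl)
    fix x
    have up0: "up 0 = (\<lambda>_. 0)" by (auto simp: up_def)
    have "norm (S 0 x) \<le> B" using base[of x] w(2)[of x] by (simp add: S_def up0 divide_simps)
    then show "norm (S g x) \<le> B + c * dist g 0"
      using diff[of g x 0] norm_triangle_sub[of "S g x" "S 0 x"] by linarith
  qed
  define R where "R g = Bcontfun (S g)" for g
  have R: "apply_bcontfun (R g) = S g" for g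
    by (simp add: R_def Bcontfun_inverse bcf)
  have "\<forall>g g'. dist (R g) (R g') \<le> c * dist g g'"
  proof (intro allI dist_bound)
    show "dist (apply_bcontfun (R g) x) (apply_bcontfun (R g') x) \<le> c * dist g g'" for g g' x
      unfolding R dist_norm[of "S g x"] by (rule diff)
  qed
  from banach_fix_type[OF c this] obtain g where Rg: "R g = g" by auto
  have g: "apply_bcontfun g x = T (up g) x /\<^sub>R w x" for x
    using fun_cong[OF R[of g, unfolded Rg], of x] unfolding S_def .
  have "up g x = T (up g) x" for x
    unfolding up_def[of g x] g using w(2)[of x] by simp
  then have "T (up g) = up g" by (intro ext) metis
  then show ?thesis using cup by blast
qed

text \<open>Integrating against \<open>exp (\<gamma> \<sigma>)\<close> gains the factor \<open>1/\<gamma>\<close>; for large \<open>\<gamma>\<close> this is what makes the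
integral terms of the fixed point equation contractive.\<close>

lemma exp_weighted_avg_bound:
  fixes f g :: "real \<Rightarrow> real"
  assumes f: "continuous_on {r..t} f" and g: "continuous_on {r..t} g" and rt: "r \<le> t"
    and \<gamma>: "\<gamma> > 0" and A: "A \<ge> 0"
    and le: "\<And>\<sigma>. \<sigma> \<in> {r..t} \<Longrightarrow> \<bar>f \<sigma> - g \<sigma>\<bar> \<le> A * exp (\<gamma> * (c + \<sigma>))"
  shows "\<bar>(t - r) * avg f r t - (t - r) * avg g r t\<bar> \<le> A * exp (\<gamma> * (c + t)) / \<gamma>"
proof -
  let ?e = "\<lambda>\<sigma>. A * exp (\<gamma> * (c + \<sigma>))"
  have e: "(?e has_integral ?e t / \<gamma> - ?e r / \<gamma>) {r..t}"
    by (rule integral_step) (use \<gamma> rt in \<open>auto intro!: continuous_intros derivative_eq_intros\<close>)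
  have "(t - r) * avg f r t - (t - r) * avg g r t = integral {r..t} (\<lambda>\<sigma>. f \<sigma> - g \<sigma>)"
    using f g by (simp add: avg_eq_integral rt integral_diff integrable_continuous_real)
  also have "\<bar>\<dots>\<bar> \<le> integral {r..t} ?e"
    unfolding real_norm_def[symmetric]
    by (rule integral_norm_bound_integral)
       (use le in \<open>auto intro!: integrable_continuous_real continuous_intros f g\<close>)
  also have "\<dots> = ?e t / \<gamma> - ?e r / \<gamma>" using e by (rule integral_unique)
  also have "\<dots> \<le> ?e t / \<gamma>" using A \<gamma> by simp
  finally show ?thesis by simp
qed

lemma abs_components_le_norm:
  fixes z :: "real \<times> real"
  shows "\<bar>fst z\<bar> \<le> norm z" "\<bar>snd z\<bar> \<le> norm z"
  using norm_fst_le[of "fst z" "snd z"] norm_snd_le[of "snd z" "fst z"] by simp_all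

lemma norm_le_abs_components:
  fixes z :: "real \<times> real"
  shows "norm z \<le> \<bar>fst z\<bar> + \<bar>snd z\<bar>"
  using norm_Pair_le[of "fst z" "snd z"] by simp

section \<open>The fixed point equation on characteristics\<close>

definition unit_clamp :: "real \<Rightarrow> real" where "unit_clamp x = max 0 (min 1 x)"

lemma unit_clamp_simps [simp]:
  "0 \<le> unit_clamp x" "unit_clamp x \<le> 1" "0 \<le> x \<Longrightarrow> x \<le> 1 \<Longrightarrow> unit_clamp x = x"
  "x \<le> 0 \<Longrightarrow> unit_clamp x = 0" "1 \<le> x \<Longrightarrow> unit_clamp x = 1"
  by (auto simp: unit_clamp_def)

lemma continuous_on_unit_clamp [continuous_intros]:
  "continuous_on S f \<Longrightarrow> continuous_on S (\<lambda>x. unit_clamp (f x))"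
  unfolding unit_clamp_def by (intro continuous_intros)

lemma continuous_on_unit_clamp_compose:
  assumes "continuous_on {0..1} f"
  shows "continuous_on UNIV (\<lambda>x. f (unit_clamp x))"
  by (rule continuous_on_compose2[OF assms]) (auto intro!: continuous_intros)

text \<open>Pairs of the label of a characteristic and a time during which it is inside \<open>0 \<le> \<eta> \<le> 1\<close>.\<close>

definition strip :: "(real \<times> real) set" where
  "strip = {(s, t). -1 \<le> s \<and> max 0 s \<le> t \<and> t \<le> s + 1}"

text \<open>A retraction onto the strip, so that the fixed point equation, which makes sense only there, can be posed for
functions on the whole plane.\<close>

definition to_strip :: "real \<times> real \<Rightarrow> real \<times> real" where
  "to_strip x = (max (-1) (fst x), max (max 0 (max (-1) (fst x))) (min (max (-1) (fst x) + 1) (snd x)))"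

lemma to_strip_in: "to_strip x \<in> strip"
  by (auto simp: to_strip_def strip_def)

lemma to_strip_id: "x \<in> strip \<Longrightarrow> to_strip x = x"
  by (auto simp: to_strip_def strip_def)

lemma continuous_on_to_strip: "continuous_on UNIV to_strip"
  unfolding to_strip_def[abs_def] by (intro continuous_intros)

text \<open>The hypotheses of the main result in the form that the existence proof uses: \<open>K\<close> stands for the drift after it has been modified outside \<open>[0,\<Phi>]\<close>, so
that \<open>k = K'\<close> is nonpositive everywhere, and \<open>m\<close> and \<open>M\<close> bound the initial \<open>H\<close>.\<close>

locale periodic_transport =
  fixes K k Qi Qi' :: "real \<Rightarrow> real" and \<Phi> L m M :: real
  assumes K_deriv: "\<And>x. (K has_real_derivative k x) (at x)"
    and k_bound: "\<And>x. \<bar>k x\<bar> \<le> L"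
    and k_Lipschitz: "\<And>x z. \<bar>k x - k z\<bar> \<le> L * \<bar>x - z\<bar>"
    and k_nonpos: "\<And>x. k x \<le> 0"
    and K_pos: "\<And>x. x \<in> {0..\<Phi>} \<Longrightarrow> 0 < K x"
    and Qi_deriv: "\<And>\<eta>. \<eta> \<in> {0..1} \<Longrightarrow> (Qi has_real_derivative Qi' \<eta>) (at \<eta> within {0..1})"
    and Qi'_cont: "continuous_on {0..1} Qi'"
    and Qi_mono: "mono_on {0..1} Qi"
    and Qi_0: "Qi 0 = 0" and Qi_1: "Qi 1 = \<Phi>"
    and compatible: "Qi' 1 - K \<Phi> = Qi' 0 - K 0"
    and m_pos: "0 < m"
    and H_bounds: "\<And>\<eta>. \<eta> \<in> {0..1} \<Longrightarrow> Qi' \<eta> - K (Qi \<eta>) \<in> {m..M}"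
begin

text \<open>The value with which the characteristic with label \<open>s\<close> enters the strip: initial data for \<open>s \<le> 0\<close>, and
the boundary value 0 for \<open>s \<ge> 0\<close>. The clamp unites the two cases, since \<open>Qi 0 = 0\<close>.\<close>

definition start :: "real \<Rightarrow> real" where "start s = Qi (unit_clamp (- s))"

text \<open>Extending \<open>h\<close> to \<open>[-1,0]\<close> by the initial values of \<open>H\<close> makes \<open>h s\<close> the value with which \<open>H\<close> enters the strip on every characteristic.\<close>

definition h_past :: "real \<Rightarrow> real" where
  "h_past s = Qi' (unit_clamp (- s)) - K (Qi (unit_clamp (- s)))"

definition clip :: "real \<Rightarrow> real" where "clip x = max m (min M x)"

text \<open>For a fixed point \<open>u\<close> this is \<open>H(\<sigma> - 1, \<sigma>)\<close> if \<open>\<sigma> \<ge> 0\<close>: the correction \<open>h_past 0 - H(-1, 0)\<close> vanishes then, by the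
compatibility condition. Its presence makes the trace continuous at \<open>\<sigma> = 0\<close> for every continuous \<open>u\<close>, so
the fixed point may be sought among all continuous functions without a side condition.\<close>

definition trace :: "(real \<times> real \<Rightarrow> real \<times> real) \<Rightarrow> real \<Rightarrow> real" where
  "trace u \<sigma> = h_past (min \<sigma> 0) + snd (u (max \<sigma> 0 - 1, max \<sigma> 0)) - snd (u (-1, 0))"

definition speed :: "(real \<times> real \<Rightarrow> real \<times> real) \<Rightarrow> real \<Rightarrow> real \<Rightarrow> real" where
  "speed u s \<sigma> = clip (trace u \<sigma>) + K (fst (u (s, \<sigma>)))"

text \<open>Without the clipping the product \<open>k(y) (H - h)\<close> would only be locally Lipschitz.\<close>

definition relax :: "(real \<times> real \<Rightarrow> real \<times> real) \<Rightarrow> real \<Rightarrow> real \<Rightarrow> real" where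
  "relax u s \<sigma> = k (fst (u (s, \<sigma>))) * (clip (snd (u (s, \<sigma>))) - clip (trace u \<sigma>))"

text \<open>The first component of \<open>u\<close> is \<open>Q\<close> and the second is \<open>H\<close>, both in the coordinates \<open>(s, t)\<close>.\<close>

definition step :: "(real \<times> real \<Rightarrow> real \<times> real) \<Rightarrow> real \<times> real \<Rightarrow> real \<times> real" where
  "step u x = (start (fst x) + (snd x - max 0 (fst x)) * avg (speed u (fst x)) (max 0 (fst x)) (snd x),
               trace u (fst x) + (snd x - max 0 (fst x)) * avg (relax u (fst x)) (max 0 (fst x)) (snd x))"

lemma L_nonneg: "0 \<le> L" using k_bound[of 0] by linarith

lemma mM: "m \<le> M" using H_bounds[of 0] by auto

lemma K_cont: "continuous_on UNIV K"
  using K_deriv DERIV_continuous_on has_field_derivative_at_within by blast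

lemma K_cont' [continuous_intros]: "continuous_on S f \<Longrightarrow> continuous_on S (\<lambda>x. K (f x))"
  by (rule continuous_on_compose2[OF K_cont]) auto

lemma k_cont: "continuous_on UNIV k"
proof (rule lipschitz_on_continuous_on)
  show "L-lipschitz_on UNIV k"
    using k_Lipschitz L_nonneg by (auto simp: lipschitz_on_def dist_real_def)
qed

lemma k_cont' [continuous_intros]: "continuous_on S f \<Longrightarrow> continuous_on S (\<lambda>x. k (f x))"
  by (rule continuous_on_compose2[OF k_cont]) auto

lemma K_Lipschitz: "\<bar>K x - K z\<bar> \<le> L * \<bar>x - z\<bar>"
proof -
  have "norm (K x - K z) \<le> L * norm (x - z)"
    by (rule field_differentiable_bound[where S = UNIV and f' = k])
       (use K_deriv k_bound in auto)
  then show ?thesis by simp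
qed

lemma Qi_cont: "continuous_on {0..1} Qi"
  using Qi_deriv by (meson DERIV_continuous_on)

lemma Qi_range: "\<eta> \<in> {0..1} \<Longrightarrow> Qi \<eta> \<in> {0..\<Phi>}"
  using Qi_mono Qi_0 Qi_1 unfolding mono_on_def
  by (metis atLeastAtMost_iff order_refl zero_le_one)

lemma start_cont [continuous_intros]: "continuous_on S f \<Longrightarrow> continuous_on S (\<lambda>x. start (f x))"
  unfolding start_def
  by (rule continuous_on_compose2[OF continuous_on_unit_clamp_compose[OF Qi_cont]])
     (auto intro!: continuous_intros)

lemma h_past_cont [continuous_intros]: "continuous_on S f \<Longrightarrow> continuous_on S (\<lambda>x. h_past (f x))"
  unfolding h_past_def
  by (intro continuous_intros continuous_on_compose2[OF continuous_on_unit_clamp_compose[OF Qi_cont]]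
       continuous_on_compose2[OF continuous_on_unit_clamp_compose[OF Qi'_cont]])
     auto

lemma clip_cont [continuous_intros]: "continuous_on S f \<Longrightarrow> continuous_on S (\<lambda>x. clip (f x))"
  unfolding clip_def by (intro continuous_intros)

lemma clip_bounds: "m \<le> clip x" "clip x \<le> M" using mM by (auto simp: clip_def)

lemma clip_id: "x \<in> {m..M} \<Longrightarrow> clip x = x" by (auto simp: clip_def)

lemma clip_Lipschitz: "\<bar>clip x - clip z\<bar> \<le> \<bar>x - z\<bar>" by (auto simp: clip_def)

lemma start_range: "start s \<in> {0..\<Phi>}"
  unfolding start_def by (rule Qi_range) simp

lemma start_nonneg [simp]: "0 \<le> s \<Longrightarrow> start s = 0"
  by (simp add: start_def Qi_0)

lemma h_past_range: "h_past s \<in> {m..M}"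
  unfolding h_past_def by (rule H_bounds) simp

lemma h_past_nonneg: "0 \<le> s \<Longrightarrow> h_past s = h_past (-1)"
  using compatible by (simp add: h_past_def Qi_0 Qi_1)

lemma trace_cont [continuous_intros]:
  assumes u: "continuous_on UNIV u" and f: "continuous_on S f"
  shows "continuous_on S (\<lambda>x. trace u (f x))"
  unfolding trace_def
  by (intro continuous_intros f continuous_on_compose2[OF u]) auto

lemma speed_cont [continuous_intros]:
  assumes u: "continuous_on UNIV u" and f: "continuous_on S f" and g: "continuous_on S g"
  shows "continuous_on S (\<lambda>x. speed u (f x) (g x))"
  unfolding speed_def
  by (intro continuous_intros f g u continuous_on_compose2[OF u]) auto

lemma relax_cont [continuous_intros]:
  assumes u: "continuous_on UNIV u" and f: "continuous_on S f" and g: "continuous_on S g"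
  shows "continuous_on S (\<lambda>x. relax u (f x) (g x))"
  unfolding relax_def
  by (intro continuous_intros f g u continuous_on_compose2[OF u]) auto

lemma step_cont:
  assumes u: "continuous_on UNIV u"
  shows "continuous_on UNIV (step u)"
proof -
  have "continuous_on UNIV (\<lambda>(x, \<sigma>). speed u (fst x) \<sigma>)" "continuous_on UNIV (\<lambda>(x, \<sigma>). relax u (fst x) \<sigma>)"
    unfolding case_prod_beta by (intro continuous_intros u)+
  then show ?thesis
    unfolding step_def[abs_def]
    by (intro continuous_intros continuous_on_avg u)
qed

text \<open>The trace at time \<open>\<sigma>\<close> reads \<open>u\<close> at \<open>(\<sigma> - 1, \<sigma>)\<close>, where the weight is \<open>exp (\<gamma> (2 \<sigma> - 1))\<close>. The weight of a point
\<open>(s, t)\<close> with \<open>s \<le> \<sigma> \<le> t \<le> s + 1\<close> is at least as large, and the weight at \<open>(s, t)\<close> exceeds the one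
for \<open>\<sigma> = s\<close> by the factor \<open>exp \<gamma>\<close> or more: the delay of one time unit is itself contractive.\<close>

lemma trace_diff:
  assumes le: "\<And>x. x \<in> strip \<Longrightarrow> norm (u x - v x) \<le> B * exp (\<gamma> * (fst x + snd x))"
    and \<gamma>: "0 \<le> \<gamma>"
  shows "\<bar>trace u \<sigma> - trace v \<sigma>\<bar> \<le> 2 * B * exp (\<gamma> * (2 * \<sigma> - 1))"
proof -
  have B: "B \<ge> 0"
    using order_trans[OF norm_ge_zero le[of "(-1, 0)"]] by (simp add: strip_def zero_le_mult_iff)
  show ?thesis
  proof (cases "\<sigma> \<ge> 0")
    case True
    have *: "\<bar>snd (u x) - snd (v x)\<bar> \<le> B * exp (\<gamma> * (fst x + snd x))" if "x \<in> strip" for x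
      using abs_components_le_norm(2)[of "u x - v x"] le[OF that] by (simp add: norm_minus_commute)
    have "\<bar>trace u \<sigma> - trace v \<sigma>\<bar> \<le> B * exp (\<gamma> * (2 * \<sigma> - 1)) + B * exp (- \<gamma>)"
      using *[of "(\<sigma> - 1, \<sigma>)"] *[of "(-1, 0)"] True by (simp add: trace_def strip_def)
    also have "B * exp (- \<gamma>) \<le> B * exp (\<gamma> * (2 * \<sigma> - 1))"
      using B \<gamma> True by (intro mult_left_mono) (auto simp: algebra_simps)
    finally show ?thesis by simp
  next
    case False
    then show ?thesis using B by (simp add: trace_def)
  qed
qed

text \<open>The constant \<open>4 + 4 L + L (M - m)\<close> collects \<open>2\<close> from the entry value of \<open>H\<close>, \<open>2 + L\<close> from the equation of \<open>Q\<close>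
and \<open>3 L + L (M - m)\<close> from the one of \<open>H\<close>; each comes with a factor \<open>1/\<gamma>\<close>.\<close>

lemma step_contraction:
  assumes u: "continuous_on UNIV u" and v: "continuous_on UNIV v"
    and le: "\<And>x. x \<in> strip \<Longrightarrow> norm (u x - v x) \<le> B * exp (\<gamma> * (fst x + snd x))"
    and \<gamma>: "\<gamma> = 2 * (4 + 4 * L + L * (M - m))" and x: "x \<in> strip"
  shows "norm (step u x - step v x) \<le> 1 / 2 * B * exp (\<gamma> * (fst x + snd x))"
proof -
  obtain s t where st: "x = (s, t)" by force
  let ?r = "max 0 s"
  have D: "-1 \<le> s" "?r \<le> t" "t \<le> s + 1" using x by (auto simp: st strip_def)
  have \<gamma>pos: "\<gamma> > 0" using L_nonneg mM by (simp add: \<gamma> add_pos_nonneg)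
  have B: "B \<ge> 0"
    using order_trans[OF norm_ge_zero le[of "(-1, 0)"]] by (simp add: strip_def zero_le_mult_iff)
  let ?e = "\<lambda>\<sigma>. exp (\<gamma> * (s + \<sigma>))"
  have comp: "\<bar>fst (u (s, \<sigma>)) - fst (v (s, \<sigma>))\<bar> \<le> B * ?e \<sigma>"
    "\<bar>snd (u (s, \<sigma>)) - snd (v (s, \<sigma>))\<bar> \<le> B * ?e \<sigma>"
    "\<bar>trace u \<sigma> - trace v \<sigma>\<bar> \<le> 2 * B * ?e \<sigma>" if "\<sigma> \<in> {?r..t}" for \<sigma>
  proof -
    have "(s, \<sigma>) \<in> strip" using that D by (auto simp: strip_def)
    from le[OF this] show "\<bar>fst (u (s, \<sigma>)) - fst (v (s, \<sigma>))\<bar> \<le> B * ?e \<sigma>"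
      "\<bar>snd (u (s, \<sigma>)) - snd (v (s, \<sigma>))\<bar> \<le> B * ?e \<sigma>"
      using abs_components_le_norm[of "u (s, \<sigma>) - v (s, \<sigma>)"] by auto
    have "\<bar>trace u \<sigma> - trace v \<sigma>\<bar> \<le> 2 * B * exp (\<gamma> * (2 * \<sigma> - 1))"
      using trace_diff[OF le] \<gamma>pos by simp
    also have "\<dots> \<le> 2 * B * ?e \<sigma>"
      using B \<gamma>pos that D by (intro mult_left_mono) auto
    finally show "\<bar>trace u \<sigma> - trace v \<sigma>\<bar> \<le> 2 * B * ?e \<sigma>" .
  qed
  have speed: "\<bar>speed u s \<sigma> - speed v s \<sigma>\<bar> \<le> ((2 + L) * B) * ?e \<sigma>" if "\<sigma> \<in> {?r..t}" for \<sigma>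
  proof -
    have "\<bar>speed u s \<sigma> - speed v s \<sigma>\<bar> \<le> \<bar>trace u \<sigma> - trace v \<sigma>\<bar> + L * \<bar>fst (u (s, \<sigma>)) - fst (v (s, \<sigma>))\<bar>"
      unfolding speed_def
      using clip_Lipschitz[of "trace u \<sigma>" "trace v \<sigma>"] K_Lipschitz[of "fst (u (s, \<sigma>))" "fst (v (s, \<sigma>))"]
      by linarith
    also have "\<dots> \<le> 2 * B * ?e \<sigma> + L * (B * ?e \<sigma>)"
      using comp[OF that] L_nonneg by (intro add_mono mult_left_mono) auto
    finally show ?thesis by (simp add: algebra_simps)
  qed
  have relax: "\<bar>relax u s \<sigma> - relax v s \<sigma>\<bar> \<le> ((3 * L + L * (M - m)) * B) * ?e \<sigma>" if "\<sigma> \<in> {?r..t}" for \<sigma>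
  proof -
    let ?p = "fst (u (s, \<sigma>))" and ?q = "fst (v (s, \<sigma>))"
    let ?cu = "clip (snd (u (s, \<sigma>))) - clip (trace u \<sigma>)" and ?cv = "clip (snd (v (s, \<sigma>))) - clip (trace v \<sigma>)"
    have split: "relax u s \<sigma> - relax v s \<sigma> = k ?p * (?cu - ?cv) + (k ?p - k ?q) * ?cv"
      by (simp add: relax_def algebra_simps)
    have "\<bar>relax u s \<sigma> - relax v s \<sigma>\<bar> \<le> \<bar>k ?p\<bar> * \<bar>?cu - ?cv\<bar> + \<bar>k ?p - k ?q\<bar> * \<bar>?cv\<bar>"
      unfolding split abs_mult[symmetric] by (rule abs_triangle_ineq)
    also have "\<dots> \<le> L * (3 * B * ?e \<sigma>) + (L * (B * ?e \<sigma>)) * (M - m)"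
    proof (intro add_mono mult_mono)
      show "\<bar>?cu - ?cv\<bar> \<le> 3 * B * ?e \<sigma>"
      proof -
        have "\<bar>?cu - ?cv\<bar> \<le> \<bar>clip (snd (u (s, \<sigma>))) - clip (snd (v (s, \<sigma>)))\<bar> + \<bar>clip (trace u \<sigma>) - clip (trace v \<sigma>)\<bar>"
          by linarith
        also have "\<dots> \<le> B * ?e \<sigma> + 2 * B * ?e \<sigma>"
          by (intro add_mono order_trans[OF clip_Lipschitz] comp[OF that])
        finally show ?thesis by simp
      qed
      show "\<bar>k ?p - k ?q\<bar> \<le> L * (B * ?e \<sigma>)"
        using k_Lipschitz[of ?p ?q] mult_left_mono[OF comp(1)[OF that] L_nonneg] by linarith
      show "\<bar>?cv\<bar> \<le> M - m"
        using clip_bounds[of "snd (v (s, \<sigma>))"] clip_bounds[of "trace v \<sigma>"] by linarith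
    qed (use L_nonneg B k_bound in auto)
    finally show ?thesis by (simp add: algebra_simps)
  qed
  have s: "\<bar>trace u s - trace v s\<bar> \<le> 2 * B * ?e t / \<gamma>"
  proof -
    have "\<bar>trace u s - trace v s\<bar> \<le> 2 * B * exp (\<gamma> * (2 * s - 1))"
      using trace_diff[OF le] \<gamma>pos by simp
    also have "exp (\<gamma> * (2 * s - 1)) \<le> exp (\<gamma> * (s + t) - \<gamma>)"
      using \<gamma>pos D by (auto simp: algebra_simps)
    also have "\<dots> = ?e t / exp \<gamma>" by (simp add: exp_diff)
    also have "\<dots> \<le> ?e t / \<gamma>"
    proof (rule divide_left_mono)
      show "\<gamma> \<le> exp \<gamma>" using exp_ge_add_one_self[of \<gamma>] by linarith
    qed (use \<gamma>pos in auto)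
    finally show ?thesis using B by (simp add: mult_left_mono)
  qed
  have "norm (step u x - step v x) \<le> \<bar>fst (step u x - step v x)\<bar> + \<bar>snd (step u x - step v x)\<bar>"
    by (rule norm_le_abs_components)
  also have "\<dots> \<le> ((2 + L) * B) * ?e t / \<gamma> + (2 * B * ?e t / \<gamma> + ((3 * L + L * (M - m)) * B) * ?e t / \<gamma>)"
  proof (intro add_mono)
    have "\<bar>(t - ?r) * avg (speed u s) ?r t - (t - ?r) * avg (speed v s) ?r t\<bar> \<le> ((2 + L) * B) * ?e t / \<gamma>"
      by (rule exp_weighted_avg_bound)
         (use speed L_nonneg B \<gamma>pos D in \<open>auto intro!: continuous_intros u v\<close>)
    then show "\<bar>fst (step u x - step v x)\<bar> \<le> ((2 + L) * B) * ?e t / \<gamma>"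
      by (simp add: step_def st)
    have "\<bar>(t - ?r) * avg (relax u s) ?r t - (t - ?r) * avg (relax v s) ?r t\<bar> \<le> ((3 * L + L * (M - m)) * B) * ?e t / \<gamma>"
      by (rule exp_weighted_avg_bound)
         (use relax L_nonneg mM B \<gamma>pos D in \<open>auto intro!: continuous_intros u v\<close>)
    then show "\<bar>snd (step u x - step v x)\<bar> \<le> 2 * B * ?e t / \<gamma> + ((3 * L + L * (M - m)) * B) * ?e t / \<gamma>"
      using s by (simp only: step_def st fst_diff snd_diff fst_conv snd_conv) linarith
  qed
  also have "\<dots> = (4 + 4 * L + L * (M - m)) / \<gamma> * (B * ?e t)"
    by (simp add: algebra_simps add_divide_distrib diff_divide_distrib)
  also have "(4 + 4 * L + L * (M - m)) / \<gamma> = 1 / 2"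
    using \<gamma>pos by (simp add: \<gamma>)
  finally show ?thesis by (simp add: st)
qed

lemma fixed_point_exists:
  "\<exists>u. continuous_on UNIV u \<and> (\<forall>x\<in>strip. u x = step u x)"
proof -
  define \<gamma> where "\<gamma> = 2 * (4 + 4 * L + L * (M - m))"
  define w where "w x = exp (\<gamma> * (fst (to_strip x) + snd (to_strip x)))" for x
  have \<gamma>pos: "\<gamma> > 0" using L_nonneg mM by (simp add: \<gamma>_def add_pos_nonneg)
  have "\<exists>u. continuous_on UNIV u \<and> (\<lambda>x. step u (to_strip x)) = u"
  proof (rule weighted_fixed_point[where w = w])
    show "continuous_on UNIV w"
      unfolding w_def by (intro continuous_intros continuous_on_to_strip)
    show "0 < w x" for x by (simp add: w_def)
    show "continuous_on UNIV (\<lambda>x. step u (to_strip x))" if "continuous_on UNIV u" for u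
      by (rule continuous_on_compose2[OF step_cont[OF that] continuous_on_to_strip]) simp
    show "norm (step u (to_strip x) - step v (to_strip x)) \<le> 1 / 2 * B * w x"
      if "continuous_on UNIV u" "continuous_on UNIV v" "\<And>x. norm (u x - v x) \<le> B * w x" for u v B x
      unfolding w_def
    proof (rule step_contraction[OF that(1,2) _ \<gamma>_def to_strip_in])
      show "norm (u x - v x) \<le> B * exp (\<gamma> * (fst x + snd x))" if "x \<in> strip" for x
        using \<open>norm (u x - v x) \<le> B * w x\<close> by (simp add: w_def to_strip_id[OF that])
    qed
    \<comment> \<open>The terms bound the entry values and the two integrands at \<open>u = 0\<close>; the weight is at least \<open>exp (- \<gamma>)\<close> as \<open>s + t \<ge> -1\<close>.\<close>
    define B0 where "B0 = (\<Phi> + (M + \<bar>K 0\<bar>)) + (M + L * (M - m))"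
    show "norm (step (\<lambda>_. 0) (to_strip x)) \<le> (B0 * exp \<gamma>) * w x" for x
    proof -
      obtain s t where st: "to_strip x = (s, t)" by force
      have D: "-1 \<le> s" "max 0 s \<le> t" "t \<le> s + 1" using to_strip_in[of x] by (auto simp: st strip_def)
      have small: "\<bar>(t - max 0 s) * c\<bar> \<le> C" if "\<bar>c\<bar> \<le> C" for c C
        using mult_mono[of "\<bar>t - max 0 s\<bar>" 1 "\<bar>c\<bar>" C] D that by (auto simp: abs_mult)
      let ?z = "\<lambda>_. 0 :: real \<times> real"
      have tr: "trace ?z \<sigma> \<in> {m..M}" for \<sigma>
        using h_past_range by (simp add: trace_def)
      have "\<bar>speed ?z s \<sigma>\<bar> \<le> M + \<bar>K 0\<bar>" for \<sigma>
        using clip_bounds[of "trace ?z \<sigma>"] m_pos by (simp add: speed_def)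
      then have 1: "\<bar>(t - max 0 s) * avg (speed ?z s) (max 0 s) t\<bar> \<le> M + \<bar>K 0\<bar>"
        by (intro small avg_bound) (auto intro!: continuous_intros)
      have "\<bar>relax ?z s \<sigma>\<bar> \<le> L * (M - m)" for \<sigma>
        unfolding relax_def abs_mult using clip_bounds[of "trace ?z \<sigma>"] clip_bounds[of "snd (?z (s, \<sigma>))"]
        by (intro mult_mono k_bound L_nonneg) auto
      then have 2: "\<bar>(t - max 0 s) * avg (relax ?z s) (max 0 s) t\<bar> \<le> L * (M - m)"
        by (intro small avg_bound) (auto intro!: continuous_intros)
      have "norm (step ?z (s, t)) \<le> \<bar>fst (step ?z (s, t))\<bar> + \<bar>snd (step ?z (s, t))\<bar>"
        by (rule norm_le_abs_components)
      also have "\<dots> \<le> B0"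
        
        unfolding step_def B0_def fst_conv snd_conv
      proof (intro add_mono order_trans[OF abs_triangle_ineq] 1 2)
        show "\<bar>start s\<bar> \<le> \<Phi>" "\<bar>trace ?z s\<bar> \<le> M"
          using tr[of s] start_range[of s] m_pos by auto
      qed
      also have "\<dots> \<le> B0 * exp (\<gamma> + \<gamma> * (s + t))"
      proof -
        have "B0 \<ge> 0" using start_range[of 0] m_pos mM L_nonneg by (simp add: B0_def)
        moreover have "\<gamma> + \<gamma> * (s + t) = \<gamma> * (1 + s + t)" by (simp add: algebra_simps)
        ultimately show ?thesis using \<gamma>pos D mult_left_mono[of 1 "exp (\<gamma> + \<gamma> * (s + t))" B0] by simp
      qed
      finally show ?thesis by (simp add: w_def st exp_add)
    qed
  qed auto
  then obtain u where u: "continuous_on UNIV u" "(\<lambda>x. step u (to_strip x)) = u" by blast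
  have "u x = step u x" if "x \<in> strip" for x
    using fun_cong[OF u(2), of x] by (simp add: to_strip_id[OF that])
  with u(1) show ?thesis by blast
qed

end

section \<open>Bounds and label derivatives along characteristics\<close>

lemma time_interval_infinity: "time_interval \<infinity> = {0..}"
  by (auto simp: time_interval_def)

locale periodic_transport_solution = periodic_transport +
  fixes u :: "real \<times> real \<Rightarrow> real \<times> real"
  assumes u_cont: "continuous_on UNIV u"
    and u_fixed: "\<And>x. x \<in> strip \<Longrightarrow> u x = step u x"
begin

definition y :: "real \<Rightarrow> real \<Rightarrow> real" where "y s t = fst (u (s, t))"

definition H :: "real \<Rightarrow> real \<Rightarrow> real" where "H s t = snd (u (s, t))"

definition h :: "real \<Rightarrow> real" where "h = trace u"

definition P :: "real \<Rightarrow> real \<Rightarrow> real" where "P s t = H s t + K (y s t)"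

lemma y_cont [continuous_intros]:
  "continuous_on S f \<Longrightarrow> continuous_on S g \<Longrightarrow> continuous_on S (\<lambda>x. y (f x) (g x))"
  unfolding y_def by (intro continuous_intros continuous_on_compose2[OF u_cont]) auto

lemma H_cont [continuous_intros]:
  "continuous_on S f \<Longrightarrow> continuous_on S g \<Longrightarrow> continuous_on S (\<lambda>x. H (f x) (g x))"
  unfolding H_def by (intro continuous_intros continuous_on_compose2[OF u_cont]) auto

lemma P_cont [continuous_intros]:
  "continuous_on S f \<Longrightarrow> continuous_on S g \<Longrightarrow> continuous_on S (\<lambda>x. P (f x) (g x))"
  unfolding P_def by (intro continuous_intros)

lemma h_cont [continuous_intros]: "continuous_on S f \<Longrightarrow> continuous_on S (\<lambda>x. h (f x))"
  unfolding h_def by (intro continuous_intros u_cont)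

lemma speed_eq: "speed u s t = clip (h t) + K (y s t)"
  by (simp add: speed_def h_def y_def)

lemma relax_eq: "relax u s t = k (y s t) * (clip (H s t) - clip (h t))"
  by (simp add: relax_def h_def y_def H_def)

lemma y_eq: "-1 \<le> s \<Longrightarrow> max 0 s \<le> t \<Longrightarrow> t \<le> s + 1 \<Longrightarrow>
    y s t = start s + (t - max 0 s) * avg (speed u s) (max 0 s) t"
  unfolding y_def by (subst u_fixed) (auto simp: strip_def step_def)

lemma H_eq: "-1 \<le> s \<Longrightarrow> max 0 s \<le> t \<Longrightarrow> t \<le> s + 1 \<Longrightarrow>
    H s t = h s + (t - max 0 s) * avg (relax u s) (max 0 s) t"
  unfolding H_def h_def by (subst u_fixed) (auto simp: strip_def step_def)

lemma y_start: "-1 \<le> s \<Longrightarrow> y s (max 0 s) = start s"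
  by (subst y_eq) auto

lemma H_start: "-1 \<le> s \<Longrightarrow> H s (max 0 s) = h s"
  by (subst H_eq) auto

lemma h_past_eq: "s \<le> 0 \<Longrightarrow> h s = h_past s"
  by (simp add: h_def trace_def max_def min_def)

lemma h_eq_H: "0 \<le> t \<Longrightarrow> h t = H (t - 1) t"
  using H_start[of "-1"] h_past_eq[of "-1"] h_past_nonneg[of 0]
  by (simp add: h_def trace_def H_def max_def min_def)

text \<open>At the end points of its life a characteristic has one-sided derivatives only; interior times and continuity
are enough for everything below.\<close>

lemma y_deriv:
  assumes "-1 \<le> s" "max 0 s < t" "t < s + 1"
  shows "(y s has_real_derivative speed u s t) (at t)"
proof -
  have cont: "continuous_on UNIV (\<lambda>\<sigma>. speed u s \<sigma>)" by (intro continuous_intros u_cont)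
  have "((\<lambda>t. start s + (t - max 0 s) * avg (speed u s) (max 0 s) t) has_real_derivative speed u s t) (at t)"
    using DERIV_add[OF DERIV_const[of "start s"] avg_antiderivative[OF cont assms(2)]] by simp
  then show ?thesis
    by (rule has_field_derivative_transform_within_open[of _ _ _ "{max 0 s<..<s + 1}"])
       (use assms y_eq in auto)
qed

lemma H_deriv:
  assumes "-1 \<le> s" "max 0 s < t" "t < s + 1"
  shows "(H s has_real_derivative relax u s t) (at t)"
proof -
  have cont: "continuous_on UNIV (\<lambda>\<sigma>. relax u s \<sigma>)" by (intro continuous_intros u_cont)
  have "((\<lambda>t. h s + (t - max 0 s) * avg (relax u s) (max 0 s) t) has_real_derivative relax u s t) (at t)"
    using DERIV_add[OF DERIV_const[of "h s"] avg_antiderivative[OF cont assms(2)]] by simp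
  then show ?thesis
    by (rule has_field_derivative_transform_within_open[of _ _ _ "{max 0 s<..<s + 1}"])
       (use assms H_eq in auto)
qed

text \<open>Above \<open>M\<close> the clipped difference \<open>M - clip (h t)\<close> is nonnegative whatever \<open>h\<close> is, so \<open>k \<le> 0\<close> pushes \<open>H\<close> back. The
bound on a whole characteristic therefore needs only the bound on its entry value.\<close>

lemma H_range:
  assumes s: "-1 \<le> s" "max 0 s \<le> t" "t \<le> s + 1" and hs: "h s \<in> {m..M}"
  shows "H s t \<in> {m..M}"
proof -
  have "H s t \<le> M"
  proof (rule barrier[where f = "H s" and f' = "relax u s" and a = "max 0 s"])
    show "relax u s \<sigma> \<le> 0" if "H s \<sigma> > M" for \<sigma>
      using that clip_bounds[of "h \<sigma>"] mM k_nonpos unfolding relax_eq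
      by (intro mult_nonpos_nonneg) (auto simp: clip_def)
  qed (use s hs H_start in \<open>auto intro!: continuous_intros H_deriv\<close>)
  moreover have "- H s t \<le> - m"
  proof (rule barrier[where f = "\<lambda>\<sigma>. - H s \<sigma>" and f' = "\<lambda>\<sigma>. - relax u s \<sigma>" and a = "max 0 s"])
    show "- relax u s \<sigma> \<le> 0" if "- H s \<sigma> > - m" for \<sigma>
      using that clip_bounds[of "h \<sigma>"] mM k_nonpos mult_nonpos_nonpos[of "k (y s \<sigma>)" "clip (H s \<sigma>) - clip (h \<sigma>)"]
      unfolding relax_eq by (auto simp: clip_def)
  qed (use s hs H_start in \<open>auto intro!: continuous_intros derivative_intros H_deriv\<close>)
  ultimately show ?thesis by simp
qed

text \<open>The value \<open>h \<sigma>\<close> is what remains of \<open>h (\<sigma> - 1)\<close> after a passage through the strip, so the bound propagates in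
steps of length 1 from the initial data.\<close>

lemma h_range: "-1 \<le> \<sigma> \<Longrightarrow> h \<sigma> \<in> {m..M}"
proof -
  have "\<forall>\<sigma>. -1 \<le> \<sigma> \<and> \<sigma> \<le> real n \<longrightarrow> h \<sigma> \<in> {m..M}" for n
  proof (induction n)
    case 0
    then show ?case using h_past_range by (simp add: h_past_eq)
  next
    case (Suc n)
    show ?case
    proof (intro allI impI)
      fix \<sigma> assume \<sigma>: "-1 \<le> \<sigma> \<and> \<sigma> \<le> real (Suc n)"
      show "h \<sigma> \<in> {m..M}"
      proof (cases "\<sigma> \<le> 0")
        case True
        then show ?thesis using h_past_range by (simp add: h_past_eq)
      next
        case False
        then have "h (\<sigma> - 1) \<in> {m..M}" using Suc \<sigma> by auto
        then show ?thesis using H_range[of "\<sigma> - 1" \<sigma>] False by (auto simp: h_eq_H)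
      qed
    qed
  qed
  moreover assume "-1 \<le> \<sigma>"
  ultimately show ?thesis using real_arch_simple[of \<sigma>] by blast
qed

text \<open>The sum \<open>P = H + K(y)\<close> is the expected \<open>\<partial>\<^sub>\<eta>Q\<close>; the terms with \<open>h\<close> in the derivatives of \<open>H\<close> and \<open>K(y)\<close> cancel and leave
\<open>P' = k(y) P\<close>.\<close>

lemma P_solution:
  assumes s: "-1 \<le> s" "max 0 s \<le> t" "t \<le> s + 1"
  shows "P s t = (h s + K (start s)) * exp ((t - max 0 s) * avg (\<lambda>\<sigma>. k (y s \<sigma>)) (max 0 s) t)"
proof -
  have "P s t = P s (max 0 s) * exp ((t - max 0 s) * avg (\<lambda>\<sigma>. k (y s \<sigma>)) (max 0 s) t)"
  proof (rule linear_ODE_solution)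
    fix \<sigma> assume \<sigma>: "max 0 s < \<sigma>" "\<sigma> < t"
    have "clip (H s \<sigma>) = H s \<sigma>" "clip (h \<sigma>) = h \<sigma>"
      using H_range[of s \<sigma>] h_range[of s] h_range[of \<sigma>] s \<sigma> by (auto intro!: clip_id)
    moreover have "(P s has_real_derivative relax u s \<sigma> + k (y s \<sigma>) * speed u s \<sigma>) (at \<sigma>)"
      unfolding P_def using s \<sigma>
      by (intro DERIV_add H_deriv DERIV_chain2[OF K_deriv] y_deriv) auto
    ultimately show "(P s has_real_derivative k (y s \<sigma>) * P s \<sigma>) (at \<sigma>)"
      by (simp add: relax_eq speed_eq P_def algebra_simps)
  qed (use s in \<open>auto intro!: continuous_intros\<close>)
  then show ?thesis using s by (simp add: P_def H_start y_start)
qed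

lemma P_pos:
  assumes s: "-1 \<le> s" "max 0 s \<le> t" "t \<le> s + 1"
  shows "0 < P s t"
  unfolding P_solution[OF assms]
  using h_range[OF s(1)] K_pos[OF start_range[of s]] m_pos
  by (intro mult_pos_pos exp_gt_zero add_pos_pos) auto

text \<open>The speeds of two characteristics at the same time differ only through \<open>K(y)\<close>, so the
difference solves a linear equation from the time on when both are inside the strip.\<close>

lemma y_difference:
  assumes s: "-1 \<le> s1" "s1 \<le> s2" "max 0 s2 \<le> t" "t \<le> s1 + 1"
  shows "y s1 t - y s2 t = (y s1 (max 0 s2) - start s2) *
    exp ((t - max 0 s2) * avg (\<lambda>\<sigma>. avg k (y s2 \<sigma>) (y s1 \<sigma>)) (max 0 s2) t)"
proof -
  have "y s1 t - y s2 t = (y s1 (max 0 s2) - y s2 (max 0 s2)) *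
    exp ((t - max 0 s2) * avg (\<lambda>\<sigma>. avg k (y s2 \<sigma>) (y s1 \<sigma>)) (max 0 s2) t)"
  proof (rule linear_ODE_solution)
    have "continuous_on UNIV (\<lambda>\<sigma>. avg k (y s2 \<sigma>) (y s1 \<sigma>))"
      by (rule continuous_on_avg) (auto intro!: continuous_intros simp: case_prod_beta)
    then show "continuous_on {max 0 s2..t} (\<lambda>\<sigma>. avg k (y s2 \<sigma>) (y s1 \<sigma>))"
      using continuous_on_subset by blast
    fix \<sigma> assume \<sigma>: "max 0 s2 < \<sigma>" "\<sigma> < t"
    have "(y s1 \<sigma> - y s2 \<sigma>) * avg k (y s2 \<sigma>) (y s1 \<sigma>) = K (y s1 \<sigma>) - K (y s2 \<sigma>)"
      by (rule avg_FTC) (rule has_field_derivative_at_within[OF K_deriv])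
    then show "((\<lambda>\<sigma>. y s1 \<sigma> - y s2 \<sigma>) has_real_derivative
        avg k (y s2 \<sigma>) (y s1 \<sigma>) * (y s1 \<sigma> - y s2 \<sigma>)) (at \<sigma>)"
      using \<sigma> s by (auto intro!: derivative_eq_intros y_deriv simp: speed_eq mult.commute)
  qed (use s in \<open>auto intro!: continuous_intros\<close>)
  then show ?thesis using s by (simp add: y_start)
qed

text \<open>Both characteristics start at time 0, and their initial distance is an increment of \<open>Qi\<close>. At equal labels
the quotient becomes the formula of \<open>P_solution\<close>.\<close>

lemma y_label_deriv_past:
  assumes s: "-1 < s" "s < 0" "0 \<le> t" "t < s + 1"
  shows "((\<lambda>s. y s t) has_real_derivative - P s t) (at s)"
proof -
  define q where "q x = Qi' (unit_clamp x)" for x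
  have q: "continuous_on UNIV q"
    unfolding q_def by (rule continuous_on_unit_clamp_compose[OF Qi'_cont])
  define E where "E x z = avg q (- z) (- x) * exp (t * avg (\<lambda>\<sigma>. avg k (y z \<sigma>) (y x \<sigma>)) 0 t)" for x z
  have "((\<lambda>s. y s t) has_real_derivative - E s s) (at s)"
  proof (rule derivative_from_quotient[where E = E and U = "{max (-1) (t - 1)<..<0}"])
    have c1: "continuous_on UNIV (\<lambda>p::real \<times> real. avg q (- snd p) (- fst p))"
      by (rule continuous_on_avg) (auto intro!: continuous_intros continuous_on_compose2[OF q] simp: case_prod_beta)
    have c2: "continuous_on UNIV (\<lambda>p. avg (\<lambda>\<sigma>. avg k (y (snd p) \<sigma>) (y (fst p) \<sigma>)) 0 t)"
    proof (rule continuous_on_avg)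
      show "continuous_on UNIV (\<lambda>(p, \<sigma>). avg k (y (snd p) \<sigma>) (y (fst p) \<sigma>))"
        unfolding case_prod_beta
        by (rule continuous_on_avg) (auto intro!: continuous_intros simp: case_prod_beta)
    qed (auto intro!: continuous_intros)
    show "continuous_on UNIV (\<lambda>(x, z). E x z)"
      unfolding E_def case_prod_beta by (intro continuous_on_mult continuous_on_exp continuous_on_diff continuous_on_const continuous_on_snd continuous_on_id c1 c2)
    fix x z assume xz: "x \<in> {max (-1) (t - 1)<..<0}" "z \<in> {max (-1) (t - 1)<..<0}" "x \<le> z"
    have "(- x - - z) * avg q (- z) (- x) = Qi (- x) - Qi (- z)"
    proof (rule avg_FTC)
      fix w assume "w \<in> closed_segment (- z) (- x)"
      moreover have sub: "closed_segment (- z) (- x) \<subseteq> {0..1}"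
        using xz by (auto simp: closed_segment_eq_real_ivl)
      ultimately show "(Qi has_real_derivative q w) (at w within closed_segment (- z) (- x))"
        using DERIV_subset[OF Qi_deriv[of w] sub] by (auto simp: q_def)
    qed
    moreover have "y x 0 = start x" "start x = Qi (- x)" "start z = Qi (- z)"
      using xz y_start[of x] by (auto simp: start_def max_absorb1)
    ultimately show "y x t - y z t = (z - x) * E x z"
      using y_difference[of x z t] xz s by (simp add: E_def max_def)
  qed (use s in auto)
  moreover have "E s s = P s t"
  proof -
    have "q (- s) = h s + K (start s)"
      using s by (simp add: q_def h_past_eq h_past_def start_def)
    then show ?thesis using s by (simp add: E_def avg_point P_solution max_def)
  qed
  ultimately show ?thesis by simp
qed

text \<open>When the later characteristic enters with value 0, the distance is what the earlier one has travelled since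
its own entry.\<close>

lemma y_label_deriv_future:
  assumes s: "0 < s" "s < t" "t < s + 1"
  shows "((\<lambda>s. y s t) has_real_derivative - P s t) (at s)"
proof -
  define E where "E x z = avg (speed u x) x z *
    exp ((t - z) * avg (\<lambda>\<sigma>. avg k (y z \<sigma>) (y x \<sigma>)) z t)" for x z
  have "((\<lambda>s. y s t) has_real_derivative - E s s) (at s)"
  proof (rule derivative_from_quotient[where E = E and U = "{max 0 (t - 1)<..<t}"])
    have c1: "continuous_on UNIV (\<lambda>p::real \<times> real. avg (speed u (fst p)) (fst p) (snd p))"
      by (rule continuous_on_avg) (auto intro!: continuous_intros u_cont simp: case_prod_beta)
    have c2: "continuous_on UNIV (\<lambda>p. avg (\<lambda>\<sigma>. avg k (y (snd p) \<sigma>) (y (fst p) \<sigma>)) (snd p) t)"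
    proof (rule continuous_on_avg)
      show "continuous_on UNIV (\<lambda>(p, \<sigma>). avg k (y (snd p) \<sigma>) (y (fst p) \<sigma>))"
        unfolding case_prod_beta
        by (rule continuous_on_avg) (auto intro!: continuous_intros simp: case_prod_beta)
    qed (auto intro!: continuous_intros)
    show "continuous_on UNIV (\<lambda>(x, z). E x z)"
      unfolding E_def case_prod_beta by (intro continuous_on_mult continuous_on_exp continuous_on_diff continuous_on_const continuous_on_snd continuous_on_id c1 c2)
    fix x z assume xz: "x \<in> {max 0 (t - 1)<..<t}" "z \<in> {max 0 (t - 1)<..<t}" "x \<le> z"
    then have "y x z - start z = (z - x) * avg (speed u x) x z"
      using y_eq[of x z] by (auto simp: max_absorb2)
    then show "y x t - y z t = (z - x) * E x z"
      using y_difference[of x z t] xz by (simp add: E_def max_absorb2)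
  qed (use s in auto)
  moreover have "E s s = P s t"
    using s y_start[of s] h_range[of s]
    by (simp add: E_def avg_point P_solution max_def speed_eq clip_id)
  ultimately show ?thesis by simp
qed

section \<open>The solution in space and time\<close>

definition Q :: "real \<Rightarrow> real \<Rightarrow> real" where "Q \<tau> \<eta> = y (\<tau> - \<eta>) \<tau>"

definition Qx :: "real \<Rightarrow> real \<Rightarrow> real" where "Qx \<tau> \<eta> = P (\<tau> - \<eta>) \<tau>"

lemma Q_cont [continuous_intros]:
  "continuous_on S f \<Longrightarrow> continuous_on S g \<Longrightarrow> continuous_on S (\<lambda>x. Q (f x) (g x))"
  unfolding Q_def by (intro continuous_intros)

lemma Qx_cont [continuous_intros]:
  "continuous_on S f \<Longrightarrow> continuous_on S g \<Longrightarrow> continuous_on S (\<lambda>x. Qx (f x) (g x))"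
  unfolding Qx_def by (intro continuous_intros)

text \<open>The label \<open>s = 0\<close>, where initial and boundary data meet, is excluded from the two preceding lemmas. The
fundamental theorem of calculus tolerates an exceptional point, and as \<open>Qx\<close> is continuous, differentiating
the integral recovers the derivative there and at the boundary.\<close>

lemma Q_space_deriv:
  assumes \<tau>: "0 \<le> \<tau>" and \<eta>: "\<eta> \<in> {0..1}"
  shows "(Q \<tau> has_real_derivative Qx \<tau> \<eta>) (at \<eta> within {0..1})"
proof -
  have int: "(Qx \<tau> has_integral Q \<tau> z - Q \<tau> 0) {0..z}" if "z \<in> {0..1}" for z
  proof (rule fundamental_theorem_of_calculus_interior_strong[where S = "{\<tau>}"])
    show "(Q \<tau> has_vector_derivative Qx \<tau> x) (at x)" if x: "x \<in> {0<..<z} - {\<tau>}" for x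
    proof -
      have "((\<lambda>s. y s \<tau>) has_real_derivative - P (\<tau> - x) \<tau>) (at (\<tau> - x))"
        using x \<tau> \<open>z \<in> {0..1}\<close> y_label_deriv_past[of "\<tau> - x" \<tau>] y_label_deriv_future[of "\<tau> - x" \<tau>]
        by (cases "x > \<tau>") auto
      moreover have "((\<lambda>x. \<tau> - x) has_real_derivative - 1) (at x)"
        by (auto intro!: derivative_eq_intros)
      ultimately have "((\<lambda>x. y (\<tau> - x) \<tau>) has_real_derivative - P (\<tau> - x) \<tau> * - 1) (at x)"
        by (rule DERIV_chain2)
      then show ?thesis
        by (simp add: Q_def[abs_def] Qx_def has_real_derivative_iff_has_vector_derivative)
    qed
  qed (use that in \<open>auto intro!: continuous_intros\<close>)
  have "((\<lambda>z. Q \<tau> 0 + integral {0..z} (Qx \<tau>)) has_real_derivative Qx \<tau> \<eta>) (at \<eta> within {0..1})"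
    by (auto intro!: derivative_eq_intros integral_has_real_derivative \<eta> continuous_intros)
  then show ?thesis
    by (rule has_field_derivative_transform_within[OF _ zero_less_one \<eta>])
       (simp add: integral_unique[OF int])
qed

lemma y_label_deriv:
  assumes "0 \<le> t" "s < t" "t < s + 1"
  shows "((\<lambda>s. y s t) has_real_derivative - P s t) (at s)"
proof -
  have "(Q t has_real_derivative Qx t (t - s)) (at (t - s))"
    using Q_space_deriv[of t "t - s"] assms by (simp add: at_within_Icc_at)
  moreover have "((\<lambda>s. t - s) has_real_derivative - 1) (at s)"
    by (auto intro!: derivative_eq_intros)
  ultimately have "((\<lambda>s. Q t (t - s)) has_real_derivative Qx t (t - s) * - 1) (at s)"
    by (rule DERIV_chain2)
  then show ?thesis by (simp add: Q_def Qx_def)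
qed

definition Qt :: "real \<Rightarrow> real \<Rightarrow> real" where "Qt \<tau> \<eta> = h \<tau> + K (Q \<tau> \<eta>) - Qx \<tau> \<eta>"

lemma Qt_cont [continuous_intros]:
  "continuous_on S f \<Longrightarrow> continuous_on S g \<Longrightarrow> continuous_on S (\<lambda>x. Qt (f x) (g x))"
  unfolding Qt_def by (intro continuous_intros)

lemma Q_time_deriv_interior:
  assumes \<tau>: "0 < \<tau>" and \<eta>: "0 < \<eta>" "\<eta> < 1"
  shows "((\<lambda>\<sigma>. Q \<sigma> \<eta>) has_real_derivative Qt \<tau> \<eta>) (at \<tau>)"
proof -
  \<comment> \<open>Half the distance to the boundary in each direction keeps a rectangle in \<open>(t, s)\<close> inside the strip.\<close>
  define e where "e = min \<tau> (min \<eta> (1 - \<eta>)) / 2"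
  have e: "0 < e" "2 * e \<le> \<tau>" "2 * e \<le> \<eta>" "2 * e \<le> 1 - \<eta>"
    using assms by (auto simp: e_def)
  have "((\<lambda>\<sigma>. (\<lambda>t s. y s t) \<sigma> (\<sigma> - \<eta>)) has_real_derivative
      (\<lambda>t s. speed u s t) \<tau> (\<tau> - \<eta>) * 1 + (\<lambda>t s. - P s t) \<tau> (\<tau> - \<eta>) * 1) (at \<tau>)"
  proof (rule chain_rule_two_variables[where f = "\<lambda>t s. y s t" and fa = "\<lambda>t s. speed u s t"
        and fb = "\<lambda>t s. - P s t" and p = "\<lambda>\<sigma>. \<sigma>" and q = "\<lambda>\<sigma>. \<sigma> - \<eta>" and X = "{\<tau> - e<..<\<tau> + e}" and Y = "{\<tau> - \<eta> - e<..<\<tau> - \<eta> + e}"])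
    show "(y (\<tau> - \<eta>) has_real_derivative speed u (\<tau> - \<eta>) \<tau>) (at \<tau>)"
      using assms by (intro y_deriv) auto
    show "((\<lambda>s. y s t) has_real_derivative - P s t) (at s)"
      if "t \<in> {\<tau> - e<..<\<tau> + e}" "s \<in> {\<tau> - \<eta> - e<..<\<tau> - \<eta> + e}" for t s
      using that e by (intro y_label_deriv) auto
  qed (use e in \<open>auto intro!: continuous_intros derivative_eq_intros simp: case_prod_beta\<close>)
  moreover have "clip (h \<tau>) = h \<tau>" using h_range[of \<tau>] \<tau> by (auto intro!: clip_id)
  ultimately show ?thesis by (simp add: Q_def Qx_def Qt_def speed_eq)
qed

text \<open>At \<open>\<eta> = 0\<close> and \<open>\<eta> = 1\<close> the time derivative cannot be read off along characteristics, which leave the strip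
there. The integrated identity extends from interior \<open>\<eta>\<close> by continuity.\<close>

lemma Q_time_integral:
  assumes \<tau>: "0 \<le> \<tau>" and \<eta>: "\<eta> \<in> {0..1}"
  shows "Q \<tau> \<eta> = Q 0 \<eta> + integral {0..\<tau>} (\<lambda>\<sigma>. Qt \<sigma> \<eta>)"
proof -
  have "Q \<tau> \<eta> - Q 0 \<eta> - (\<tau> - 0) * avg (\<lambda>\<sigma>. Qt \<sigma> \<eta>) 0 \<tau> = 0"
  proof (rule zero_on_closed_unit_interval[OF _ _ \<eta>])
    have "continuous_on UNIV (\<lambda>\<eta>. avg (\<lambda>\<sigma>. Qt \<sigma> \<eta>) 0 \<tau>)"
      by (rule continuous_on_avg) (auto intro!: continuous_intros simp: case_prod_beta)
    then have "continuous_on {0..1} (\<lambda>\<eta>. avg (\<lambda>\<sigma>. Qt \<sigma> \<eta>) 0 \<tau>)"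
      using continuous_on_subset by blast
    then show "continuous_on {0..1} (\<lambda>\<eta>. Q \<tau> \<eta> - Q 0 \<eta> - (\<tau> - 0) * avg (\<lambda>\<sigma>. Qt \<sigma> \<eta>) 0 \<tau>)"
      by (intro continuous_intros)
    fix x :: real assume x: "0 < x" "x < 1"
    have "((\<lambda>\<sigma>. Qt \<sigma> x) has_integral Q \<tau> x - Q 0 x) {0..\<tau>}"
      using x \<tau> by (intro integral_step) (auto intro!: continuous_intros Q_time_deriv_interior)
    then have "integral {0..\<tau>} (\<lambda>\<sigma>. Qt \<sigma> x) = Q \<tau> x - Q 0 x" by (rule integral_unique)
    then show "Q \<tau> x - Q 0 x - (\<tau> - 0) * avg (\<lambda>\<sigma>. Qt \<sigma> x) 0 \<tau> = 0"
      by (subst avg_eq_integral) (auto intro!: continuous_intros \<tau>)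
  qed
  then show ?thesis
    by (subst (asm) avg_eq_integral) (auto intro!: continuous_intros \<tau>)
qed

lemma Q_time_deriv:
  assumes \<tau>: "0 \<le> \<tau>" and \<eta>: "\<eta> \<in> {0..1}"
  shows "((\<lambda>\<sigma>. Q \<sigma> \<eta>) has_real_derivative Qt \<tau> \<eta>) (at \<tau> within {0..})"
proof -
  have "continuous_on {0..\<tau> + 1} (\<lambda>\<sigma>. Qt \<sigma> \<eta>)" by (intro continuous_intros)
  then have "((\<lambda>\<sigma>. integral {0..\<sigma>} (\<lambda>\<sigma>. Qt \<sigma> \<eta>)) has_real_derivative Qt \<tau> \<eta>) (at \<tau> within {0..\<tau> + 1})"
    by (rule integral_has_real_derivative) (use \<tau> in auto)
  from DERIV_add[OF DERIV_const[of "Q 0 \<eta>"] this]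
  have "((\<lambda>\<sigma>. Q 0 \<eta> + integral {0..\<sigma>} (\<lambda>\<sigma>. Qt \<sigma> \<eta>)) has_real_derivative Qt \<tau> \<eta>) (at \<tau> within {0..\<tau> + 1})"
    by simp
  then have "((\<lambda>\<sigma>. Q \<sigma> \<eta>) has_real_derivative Qt \<tau> \<eta>) (at \<tau> within {0..\<tau> + 1})"
  proof (rule has_field_derivative_transform_within[OF _ zero_less_one])
    show "Q 0 \<eta> + integral {0..\<sigma>} (\<lambda>\<sigma>. Qt \<sigma> \<eta>) = Q \<sigma> \<eta>" if "\<sigma> \<in> {0..\<tau> + 1}" for \<sigma>
      using Q_time_integral[OF _ \<eta>, of \<sigma>] that by simp
  qed (use \<tau> in auto)
  moreover have "at \<tau> within {0..\<tau> + 1} = at \<tau> within {0..}"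
    by (rule at_within_nhd[where S = "{..<\<tau> + 1}"]) auto
  ultimately show ?thesis by simp
qed

lemma Q_init: "\<eta> \<in> {0..1} \<Longrightarrow> Q 0 \<eta> = Qi \<eta>"
  using y_start[of "- \<eta>"] by (simp add: Q_def start_def max_absorb1)

lemma Q_left: "0 \<le> \<tau> \<Longrightarrow> Q \<tau> 0 = 0"
  using y_start[of \<tau>] by (simp add: Q_def max_absorb2)

lemma Qx_right: "0 \<le> \<tau> \<Longrightarrow> Qx \<tau> 1 = h \<tau> + K (Q \<tau> 1)"
  by (simp add: Qx_def P_def Q_def h_eq_H)

text \<open>Here the fixed point property of \<open>h\<close> enters: by \<open>Qx_right\<close> the time derivative of \<open>Q\<close> vanishes on \<open>\<eta> = 1\<close>.\<close>

lemma Q_right: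
  assumes "0 \<le> \<tau>"
  shows "Q \<tau> 1 = \<Phi>"
proof -
  have "integral {0..\<tau>} (\<lambda>\<sigma>. Qt \<sigma> 1) = integral {0..\<tau>} (\<lambda>_. 0)"
    by (rule integral_cong) (simp add: Qt_def Qx_right)
  then show ?thesis using Q_time_integral[OF assms, of 1] by (simp add: Q_init Qi_1)
qed

lemma Q_mono: "0 \<le> \<tau> \<Longrightarrow> mono_on {0..1} (Q \<tau>)"
proof (rule mono_onI)
  fix a b :: real assume \<tau>: "0 \<le> \<tau>" and ab: "a \<in> {0..1}" "b \<in> {0..1}" "a \<le> b"
  have "- Q \<tau> b \<le> - Q \<tau> a"
  proof (rule barrier[where f = "\<lambda>x. - Q \<tau> x" and f' = "\<lambda>x. - Qx \<tau> x" and a = a])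
    fix x assume x: "a < x" "x < b"
    have "(Q \<tau> has_real_derivative Qx \<tau> x) (at x)"
      using Q_space_deriv[OF \<tau>, of x] x ab by (simp add: at_within_Icc_at)
    then show "((\<lambda>x. - Q \<tau> x) has_real_derivative - Qx \<tau> x) (at x)"
      by (rule DERIV_minus)
    show "- Qx \<tau> x \<le> 0"
      using P_pos[of "\<tau> - x" \<tau>] x ab \<tau> by (simp add: Qx_def)
  qed (use ab in \<open>auto intro!: continuous_intros\<close>)
  then show "Q \<tau> a \<le> Q \<tau> b" by simp
qed

text \<open>Monotonicity confines \<open>Q\<close> between its boundary values; in this range every drift that extends the given one
from \<open>[0,\<Phi>]\<close> yields the same equation.\<close>

lemma Q_range:
  assumes "0 \<le> \<tau>" "\<eta> \<in> {0..1}"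
  shows "Q \<tau> \<eta> \<in> {0..\<Phi>}"
  using mono_onD[OF Q_mono[OF assms(1)], of 0 \<eta>] mono_onD[OF Q_mono[OF assms(1)], of \<eta> 1] assms
  by (simp add: Q_left Q_right)

lemma h_pos: "0 \<le> \<tau> \<Longrightarrow> 0 < h \<tau>"
  using h_range[of \<tau>] m_pos by simp

lemma classical_solution_Q:
  assumes K0: "\<And>x. x \<in> {0..\<Phi>} \<Longrightarrow> K0 x = K x"
  shows "classical_solution K0 \<Phi> Qi \<infinity> Q (\<lambda>\<tau>. 1 / h \<tau>)"
proof -
  have "0 \<le> \<Phi>" using start_range[of 0] by simp
  then have K0\<Phi>: "K0 \<Phi> = K \<Phi>" using K0 by simp
  have 1: "C1_with_partials (time_interval \<infinity>) {0..1} Q Qt Qx"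
    unfolding C1_with_partials_def time_interval_infinity case_prod_beta
    using Q_time_deriv Q_space_deriv by (auto intro!: continuous_intros)
  have 2: "system_S K0 \<Phi> Qi \<infinity> Q Qt Qx (\<lambda>\<tau>. 1 / h \<tau>)"
    unfolding system_S_def
    using K0[OF Q_range] by (auto simp: Qt_def Q_left Qx_right Q_right K0\<Phi> Q_init)
  have 3: "continuous_on {0..} (\<lambda>\<tau>. 1 / h \<tau>)"
    using h_pos by (intro continuous_intros) force
  show ?thesis
    unfolding classical_solution_def
    using 1 2 3 h_pos by (intro exI[of _ Qt] exI[of _ Qx])
      (auto simp: time_interval_infinity Q_mono Qx_right Q_right K0\<Phi>)
qed

end

section \<open>Uniqueness\<close>

text \<open>What uniqueness uses of a classical solution, with \<open>h = 1/N\<close>. The values of \<open>\<partial>\<^sub>\<eta>Q\<close>, and with them the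
firing condition, occur only through \<open>Q \<tau> 1 = \<Phi>\<close>.\<close>

definition firing_characteristics ::
  "(real \<Rightarrow> real) \<Rightarrow> real \<Rightarrow> (real \<Rightarrow> real) \<Rightarrow> (real \<Rightarrow> real \<Rightarrow> real) \<Rightarrow> (real \<Rightarrow> real) \<Rightarrow> bool" where
  "firing_characteristics K \<Phi> Qi Q h \<longleftrightarrow>
     continuous_on ({0..} \<times> {0..1}) (\<lambda>(t, x). Q t x) \<and> continuous_on {0..} h \<and>
     (\<forall>\<tau>\<ge>0. Q \<tau> 0 = 0 \<and> Q \<tau> 1 = \<Phi>) \<and> (\<forall>\<eta>\<in>{0..1}. Q 0 \<eta> = Qi \<eta>) \<and>
     (\<forall>s t. max 0 s < t \<and> t < s + 1 \<longrightarrow>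
        ((\<lambda>t. Q t (t - s)) has_real_derivative h t + K (Q t (t - s))) (at t))"

text \<open>The transport equation extends to \<open>\<eta> = 1\<close> by continuity. With the firing condition it becomes the autonomous
equation \<open>z' = K(z) - K(\<Phi>)\<close> for \<open>z = Q(\<tau>,1)\<close>, whose solution with \<open>z(0) = \<Phi>\<close> is constant.\<close>

lemma classical_solution_characteristics:
  assumes K: "\<And>x. (K has_real_derivative k x) (at x)" and k: "continuous_on UNIV k"
    and Qi: "Qi 0 = 0" "Qi 1 = \<Phi>" and sol: "classical_solution K \<Phi> Qi \<infinity> Q N"
  shows "firing_characteristics K \<Phi> Qi Q (\<lambda>\<tau>. 1 / N \<tau>)"
proof -
  obtain Qt Qx where C1: "C1_with_partials {0..} {0..1} Q Qt Qx"
    and N: "continuous_on {0..} N" "\<And>\<tau>. 0 \<le> \<tau> \<Longrightarrow> N \<tau> > 0"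
    and sys: "system_S K \<Phi> Qi \<infinity> Q Qt Qx N"
    using sol unfolding classical_solution_def time_interval_infinity by auto
  have dt: "((\<lambda>s. Q s x) has_real_derivative Qt t x) (at t within {0..})"
    and dx: "((\<lambda>y. Q t y) has_real_derivative Qx t x) (at x within {0..1})"
    if "0 \<le> t" "x \<in> {0..1}" for t x
    using C1 that by (auto simp: C1_with_partials_def)
  have cQ: "continuous_on ({0..} \<times> {0..1}) (\<lambda>(t, x). Q t x)"
    and cQt: "continuous_on ({0..} \<times> {0..1}) (\<lambda>(t, x). Qt t x)"
    and cQx: "continuous_on ({0..} \<times> {0..1}) (\<lambda>(t, x). Qx t x)"
    using C1 by (auto simp: C1_with_partials_def)
  have pde: "Qt \<tau> \<eta> + Qx \<tau> \<eta> = 1 / N \<tau> + K (Q \<tau> \<eta>)" if "0 < \<tau>" "0 < \<eta>" "\<eta> < 1" for \<tau> \<eta>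
    using sys that by (auto simp: system_S_def)
  have left: "Q \<tau> 0 = 0" and firing: "1 / N \<tau> = Qx \<tau> 1 - K \<Phi>" if "0 < \<tau>" for \<tau>
    using sys that by (auto simp: system_S_def)
  have init: "Q 0 \<eta> = Qi \<eta>" if "\<eta> \<in> {0..1}" for \<eta>
    using sys that by (auto simp: system_S_def)
  have slice: "continuous_on {0..1} (\<lambda>x. f t x)"
    if "continuous_on ({0..} \<times> {0..1}) (\<lambda>(t, x). f t x)" "0 \<le> t" for f :: "real \<Rightarrow> real \<Rightarrow> real" and t
  proof -
    have "continuous_on {0..1} (\<lambda>x. (\<lambda>(t, x). f t x) (t, x))"
      by (rule continuous_on_compose2[OF that(1)]) (use that(2) in \<open>auto intro!: continuous_intros\<close>)
    then show ?thesis by simp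
  qed
  have K_cont: "continuous_on UNIV K"
    using K DERIV_continuous_on has_field_derivative_at_within by blast
  have "Qt \<tau> 1 + Qx \<tau> 1 - 1 / N \<tau> - K (Q \<tau> 1) = 0" if "0 < \<tau>" for \<tau>
  proof (rule zero_on_closed_unit_interval[where f = "\<lambda>x. Qt \<tau> x + Qx \<tau> x - 1 / N \<tau> - K (Q \<tau> x)"])
    show "continuous_on {0..1} (\<lambda>x. Qt \<tau> x + Qx \<tau> x - 1 / N \<tau> - K (Q \<tau> x))"
      using that by (intro continuous_intros slice[OF cQt] slice[OF cQx]
          continuous_on_compose2[OF K_cont slice[OF cQ]]) auto
  qed (use pde that in auto)
  then have edge: "Qt \<tau> 1 = K (Q \<tau> 1) - K \<Phi>" if "0 < \<tau>" for \<tau>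
    using firing[OF that] that by fastforce
  have right: "Q \<tau> 1 = \<Phi>" if "0 \<le> \<tau>" for \<tau>
  proof -
    have cont: "continuous_on {0..\<tau>} (\<lambda>t. Q t 1)"
    proof -
      have "continuous_on {0..\<tau>} (\<lambda>t. (\<lambda>(t, x). Q t x) (t, 1))"
        by (rule continuous_on_compose2[OF cQ]) (auto intro!: continuous_intros)
      then show ?thesis by simp
    qed
    have "Q \<tau> 1 - \<Phi> = (Q 0 1 - \<Phi>) * exp ((\<tau> - 0) * avg (\<lambda>t. avg k \<Phi> (Q t 1)) 0 \<tau>)"
    proof (rule linear_ODE_solution)
      show "continuous_on {0..\<tau>} (\<lambda>t. avg k \<Phi> (Q t 1))"
        by (intro continuous_on_avg_endpoints k cont continuous_on_const)
      show "continuous_on {0..\<tau>} (\<lambda>t. Q t 1 - \<Phi>)" by (intro continuous_intros cont)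
      fix t assume t: "0 < t" "t < \<tau>"
      have "((\<lambda>t. Q t 1) has_real_derivative Qt t 1) (at t within {0..})" using dt t by auto
      then have "((\<lambda>t. Q t 1) has_real_derivative Qt t 1) (at t)"
        using t at_within_interior[of t "{0..}"] by simp
      moreover have "(Q t 1 - \<Phi>) * avg k \<Phi> (Q t 1) = K (Q t 1) - K \<Phi>"
        by (rule avg_FTC) (rule has_field_derivative_at_within[OF K])
      ultimately show "((\<lambda>t. Q t 1 - \<Phi>) has_real_derivative avg k \<Phi> (Q t 1) * (Q t 1 - \<Phi>)) (at t)"
        using edge[OF t(1)] by (auto intro!: derivative_eq_intros simp: mult.commute)
    qed fact
    then show ?thesis by (simp add: init Qi)
  qed
  have char: "((\<lambda>t. Q t (t - s)) has_real_derivative 1 / N t + K (Q t (t - s))) (at t)"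
    if "max 0 s < t" "t < s + 1" for s t
  proof -
    have "((\<lambda>t. Q t (t - s)) has_real_derivative Qt t (t - s) * 1 + Qx t (t - s) * 1) (at t)"
    proof (rule chain_rule_two_variables[where f = Q and fa = Qt and fb = Qx and p = "\<lambda>t. t"
          and q = "\<lambda>t. t - s" and X = "{0<..}" and Y = "{0<..<1}"])
      have "((\<lambda>x. Q x (t - s)) has_real_derivative Qt t (t - s)) (at t within {0..})"
        using dt that by auto
      then show "((\<lambda>x. Q x (t - s)) has_real_derivative Qt t (t - s)) (at t)"
        using that at_within_interior[of t "{0..}"] by simp
      show "(Q x has_real_derivative Qx x y) (at y)" if "x \<in> {0<..}" "y \<in> {0<..<1}" for x y
        using dx[of x y] that by (simp add: at_within_Icc_at)
      show "continuous_on ({0<..} \<times> {0<..<1}) (\<lambda>(x, y). Qx x y)"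
        by (rule continuous_on_subset[OF cQx]) auto
    qed (use that in \<open>auto intro!: derivative_eq_intros\<close>)
    then show ?thesis using pde[of t "t - s"] that by simp
  qed
  have "continuous_on {0..} (\<lambda>\<tau>. 1 / N \<tau>)"
    using N by (intro continuous_intros) force+
  moreover have "Q \<tau> 0 = 0" if "0 \<le> \<tau>" for \<tau>
    using left[of \<tau>] init[of 0] Qi that by (cases "\<tau> = 0") auto
  ultimately show ?thesis
    unfolding firing_characteristics_def using cQ right init char by auto
qed

text \<open>Subtracting \<open>g\<close> removes \<open>h1 - h2\<close> from the equation of \<open>Q1 - Q2\<close> and leaves \<open>d' = \<kappa> (d + g)\<close> with \<open>d = 0\<close> at the
entry.\<close>

lemma firing_characteristics_difference_bound:
  assumes K: "\<And>x. (K has_real_derivative k x) (at x)" and k: "continuous_on UNIV k" and k_le: "\<And>x. \<bar>k x\<bar> \<le> L"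
    and 1: "firing_characteristics K \<Phi> Qi Q1 h1" and 2: "firing_characteristics K \<Phi> Qi Q2 h2"
    and g_cont: "continuous_on {0..} g"
    and g_deriv: "\<And>t. 0 < t \<Longrightarrow> (g has_real_derivative h1 t - h2 t) (at t)"
    and s: "-1 \<le> s" "max 0 s \<le> t" "t \<le> s + 1" and g0: "g (max 0 s) = 0"
  shows "\<bar>Q1 t (t - s) - Q2 t (t - s) - g t\<bar> \<le> L * exp (2 * L) * integral {max 0 s..t} (\<lambda>t. \<bar>g t\<bar>)"
proof (rule perturbed_linear_ODE_bound[where d = "\<lambda>t. Q1 t (t - s) - Q2 t (t - s) - g t"
      and \<kappa> = "\<lambda>t. avg k (Q2 t (t - s)) (Q1 t (t - s))"])
  have along: "continuous_on {max 0 s..t} (\<lambda>t. Q t (t - s))"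
    if "firing_characteristics K \<Phi> Qi Q h" for Q h
  proof -
    have "continuous_on ({0..} \<times> {0..1}) (\<lambda>(t, x). Q t x)"
      using that by (simp add: firing_characteristics_def)
    then have "continuous_on {max 0 s..t} (\<lambda>t. (\<lambda>(t, x). Q t x) (t, t - s))"
      by (rule continuous_on_compose2) (use s in \<open>auto intro!: continuous_intros\<close>)
    then show ?thesis by simp
  qed
  have g: "continuous_on {max 0 s..t} g" using g_cont by (rule continuous_on_subset) auto
  show "continuous_on {max 0 s..t} (\<lambda>t. avg k (Q2 t (t - s)) (Q1 t (t - s)))"
    by (intro continuous_on_avg_endpoints k along[OF 1] along[OF 2])
  show "continuous_on {max 0 s..t} (\<lambda>t. Q1 t (t - s) - Q2 t (t - s) - g t)"
    by (intro continuous_intros along[OF 1] along[OF 2] g)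
  show "continuous_on {max 0 s..t} g" by fact
  show "max 0 s \<le> t" "t \<le> max 0 s + 1" using s by auto
  show "\<bar>avg k (Q2 t (t - s)) (Q1 t (t - s))\<bar> \<le> L" for t
    by (rule avg_bound[OF k k_le])
  show "Q1 (max 0 s) (max 0 s - s) - Q2 (max 0 s) (max 0 s - s) - g (max 0 s) = 0"
    using 1 2 g0 s by (cases "0 \<le> s") (auto simp: firing_characteristics_def max_absorb1 max_absorb2)
  fix \<sigma> assume \<sigma>: "max 0 s < \<sigma>" "\<sigma> < t"
  then have d: "((\<lambda>t. Q1 t (t - s)) has_real_derivative h1 \<sigma> + K (Q1 \<sigma> (\<sigma> - s))) (at \<sigma>)"
    "((\<lambda>t. Q2 t (t - s)) has_real_derivative h2 \<sigma> + K (Q2 \<sigma> (\<sigma> - s))) (at \<sigma>)"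
    using 1 2 s by (auto simp: firing_characteristics_def)
  have "(Q1 \<sigma> (\<sigma> - s) - Q2 \<sigma> (\<sigma> - s)) * avg k (Q2 \<sigma> (\<sigma> - s)) (Q1 \<sigma> (\<sigma> - s)) =
      K (Q1 \<sigma> (\<sigma> - s)) - K (Q2 \<sigma> (\<sigma> - s))"
    by (rule avg_FTC) (rule has_field_derivative_at_within[OF K])
  moreover have "((\<lambda>t. Q1 t (t - s) - Q2 t (t - s) - g t) has_real_derivative
      (h1 \<sigma> + K (Q1 \<sigma> (\<sigma> - s))) - (h2 \<sigma> + K (Q2 \<sigma> (\<sigma> - s))) - (h1 \<sigma> - h2 \<sigma>)) (at \<sigma>)"
    using \<sigma> by (intro DERIV_diff d g_deriv) auto
  ultimately show "((\<lambda>t. Q1 t (t - s) - Q2 t (t - s) - g t) has_real_derivative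
      avg k (Q2 \<sigma> (\<sigma> - s)) (Q1 \<sigma> (\<sigma> - s)) *
      (Q1 \<sigma> (\<sigma> - s) - Q2 \<sigma> (\<sigma> - s) - g \<sigma> + g \<sigma>)) (at \<sigma>)"
    by (simp add: mult.commute)
qed

lemma firing_characteristics_unique:
  assumes K: "\<And>x. (K has_real_derivative k x) (at x)" and k: "continuous_on UNIV k" and k_le: "\<And>x. \<bar>k x\<bar> \<le> L"
    and 1: "firing_characteristics K \<Phi> Qi Q1 h1" and 2: "firing_characteristics K \<Phi> Qi Q2 h2"
    and \<tau>: "0 \<le> \<tau>"
  shows "h1 \<tau> = h2 \<tau>" "\<eta> \<in> {0..1} \<Longrightarrow> Q1 \<tau> \<eta> = Q2 \<tau> \<eta>"
proof -
  define g where "g t = integral {0..t} (\<lambda>\<sigma>. h1 \<sigma> - h2 \<sigma>)" for t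
  have h: "continuous_on {0..t} (\<lambda>\<sigma>. h1 \<sigma> - h2 \<sigma>)" for t
    using 1 2 by (intro continuous_intros) (auto simp: firing_characteristics_def elim: continuous_on_subset)
  have g_within: "(g has_real_derivative h1 t - h2 t) (at t within {0..T})" if "t \<in> {0..T}" for t T
    unfolding g_def[abs_def] by (rule integral_has_real_derivative[OF h that])
  have g_deriv: "(g has_real_derivative h1 t - h2 t) (at t)" if "0 < t" for t
    using g_within[of t "t + 1"] that by (simp add: at_within_Icc_at)
  have g_cont: "continuous_on {0..} g"
  proof (rule DERIV_continuous_on)
    fix t :: real assume "t \<in> {0..}"
    moreover have "at t within {0..t + 1} = at t within {0..}"
      by (rule at_within_nhd[where S = "{..<t + 1}"]) auto
    ultimately show "(g has_real_derivative h1 t - h2 t) (at t within {0..})"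
      using g_within[of t "t + 1"] by simp
  qed
  have g_cont': "continuous_on {a..b} g" if "0 \<le> a" for a b
    using g_cont by (rule continuous_on_subset) (use that in auto)
  have L: "0 \<le> L" using k_le[of 0] by linarith
  have "\<forall>t\<in>{0..real n}. g t = 0" for n
  proof (induction n)
    case 0
    then show ?case by (simp add: g_def)
  next
    case (Suc n)
    \<comment> \<open>The characteristic that ends at time \<open>t\<close> has the label \<open>t - 1 \<le> n\<close>, so \<open>g\<close> vanishes when it enters.\<close>
    have "\<bar>g t\<bar> = 0" if "t \<in> {0..real (Suc n)}" for t
    proof (rule Gronwall_zero[where u = "\<lambda>t. \<bar>g t\<bar>", OF _ _ _ that])
      show "continuous_on {0..real (Suc n)} (\<lambda>t. \<bar>g t\<bar>)"
        by (intro continuous_intros g_cont') simp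
      fix t assume t: "t \<in> {0..real (Suc n)}"
      have "\<bar>Q1 t (t - (t - 1)) - Q2 t (t - (t - 1)) - g t\<bar>
          \<le> L * exp (2 * L) * integral {max 0 (t - 1)..t} (\<lambda>t. \<bar>g t\<bar>)"
        by (rule firing_characteristics_difference_bound[OF K k k_le 1 2 g_cont g_deriv])
           (use t Suc in auto)
      then have "\<bar>g t\<bar> \<le> L * exp (2 * L) * integral {max 0 (t - 1)..t} (\<lambda>t. \<bar>g t\<bar>)"
        using 1 2 t by (simp add: firing_characteristics_def)
      also have "\<dots> \<le> L * exp (2 * L) * integral {0..t} (\<lambda>t. \<bar>g t\<bar>)"
        using L by (intro mult_left_mono integral_subset_le integrable_continuous_real continuous_intros g_cont') auto
      finally show "\<bar>g t\<bar> \<le> L * exp (2 * L) * integral {0..t} (\<lambda>t. \<bar>g t\<bar>)" .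
    qed auto
    then show ?case by simp
  qed
  then have g0: "g t = 0" if "0 \<le> t" for t
    using real_arch_simple[of t] that by auto
  have "((\<lambda>_. 0) has_real_derivative h1 \<tau> - h2 \<tau>) (at \<tau> within {0..\<tau> + 1})"
    using g_within[of \<tau> "\<tau> + 1"]
    by (rule has_field_derivative_transform_within[OF _ zero_less_one]) (use \<tau> g0 in auto)
  moreover have "((\<lambda>_. 0) has_real_derivative 0) (at \<tau> within {0..\<tau> + 1})" by simp
  ultimately have "h1 \<tau> - h2 \<tau> = 0"
    using vector_derivative_unique_within_closed_interval[of 0 "\<tau> + 1" \<tau> "\<lambda>_. 0" "h1 \<tau> - h2 \<tau>" 0] \<tau>
    by (simp add: has_real_derivative_iff_has_vector_derivative)
  then show "h1 \<tau> = h2 \<tau>" by simp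
  assume \<eta>: "\<eta> \<in> {0..1}"
  have "\<bar>Q1 \<tau> (\<tau> - (\<tau> - \<eta>)) - Q2 \<tau> (\<tau> - (\<tau> - \<eta>)) - g \<tau>\<bar>
      \<le> L * exp (2 * L) * integral {max 0 (\<tau> - \<eta>)..\<tau>} (\<lambda>t. \<bar>g t\<bar>)"
    by (rule firing_characteristics_difference_bound[OF K k k_le 1 2 g_cont g_deriv])
       (use \<eta> \<tau> g0 in auto)
  also have "integral {max 0 (\<tau> - \<eta>)..\<tau>} (\<lambda>t. \<bar>g t\<bar>) = integral {max 0 (\<tau> - \<eta>)..\<tau>} (\<lambda>t. 0)"
    by (rule integral_cong) (use g0 in auto)
  finally show "Q1 \<tau> \<eta> = Q2 \<tau> \<eta>" using g0[OF \<tau>] by simp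
qed

section \<open>Extending the drift, and the main result\<close>

text \<open>Integrating \<open>K'\<close>, frozen at its end values outside \<open>[0,\<Phi>]\<close>, gives an extension of \<open>K\<close> from \<open>[0,\<Phi>]\<close> that
decreases on the whole line and keeps the Lipschitz bounds.\<close>

lemma monotone_extension:
  fixes K K' K'' :: "real \<Rightarrow> real"
  assumes \<Phi>: "0 \<le> \<Phi>" and K: "\<And>x. (K has_real_derivative K' x) (at x)"
    and K': "\<And>x. (K' has_real_derivative K'' x) (at x)"
    and bdd: "\<And>x. \<bar>K' x\<bar> \<le> L" "\<And>x. \<bar>K'' x\<bar> \<le> L"
    and nonpos: "\<And>x. x \<in> {0..\<Phi>} \<Longrightarrow> K' x \<le> 0"
  obtains F f where "\<And>x. (F has_real_derivative f x) (at x)" "\<And>x. \<bar>f x\<bar> \<le> L"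
    "\<And>x z. \<bar>f x - f z\<bar> \<le> L * \<bar>x - z\<bar>" "\<And>x. f x \<le> 0" "\<And>x. x \<in> {0..\<Phi>} \<Longrightarrow> F x = K x"
proof -
  let ?c = "\<lambda>x. max 0 (min \<Phi> x)"
  define f where "f x = K' (?c x)" for x
  have L: "0 \<le> L" using bdd(1)[of 0] by linarith
  have Lip: "\<bar>f x - f z\<bar> \<le> L * \<bar>x - z\<bar>" for x z
  proof -
    have "norm (K' (?c x) - K' (?c z)) \<le> L * norm (?c x - ?c z)"
      by (rule field_differentiable_bound[where S = UNIV and f' = K'']) (use K' bdd in auto)
    also have "\<dots> \<le> L * \<bar>x - z\<bar>" using L by (intro mult_left_mono) auto
    finally show ?thesis by (simp add: f_def)
  qed
  have "L-lipschitz_on UNIV f" using Lip L by (auto simp: lipschitz_on_def dist_real_def)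
  then have cont: "isCont f x" for x
    by (meson UNIV_I continuous_on_eq_continuous_at lipschitz_on_continuous_on open_UNIV)
  obtain G where G: "\<And>x. (G has_vector_derivative f x) (at x)"
    using einterval_antiderivative[of "-\<infinity>" \<infinity> f] cont by auto
  define F where "F x = G x - G 0 + K 0" for x
  have F: "(F has_real_derivative f x) (at x)" for x
    unfolding F_def using G[of x]
    by (auto intro!: derivative_eq_intros simp: has_real_derivative_iff_has_vector_derivative[symmetric])
  have "F x = K x" if "x \<in> {0..\<Phi>}" for x
  proof -
    have "((\<lambda>_. 0) has_integral (F x - K x) - (F 0 - K 0)) {0..x}"
    proof (rule integral_step[where f = "\<lambda>x. F x - K x"])
      show "continuous_on {0..x} (\<lambda>x. F x - K x)"
        using F K by (intro continuous_intros) (meson DERIV_continuous_on has_field_derivative_at_within)+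
      show "((\<lambda>x. F x - K x) has_real_derivative 0) (at z)" if "z \<in> {0<..<x}" for z
        using DERIV_diff[OF F[of z] K[of z]] that \<open>x \<in> {0..\<Phi>}\<close> by (simp add: f_def)
    qed (use that in auto)
    then show ?thesis by (simp add: has_integral_0_eq F_def)
  qed
  moreover have "f x \<le> 0" for x using nonpos[of "?c x"] \<Phi> by (simp add: f_def)
  moreover have "\<bar>f x\<bar> \<le> L" for x unfolding f_def by (rule bdd)
  ultimately show ?thesis using that F Lip by blast
qed

theorem theorem5p1:
  fixes K K' K'' Q\<^sub>i Q\<^sub>i' :: "real \<Rightarrow> real" and \<Phi>\<^sub>F :: real
  assumes "\<Phi>\<^sub>F > 0"
    and "\<And>x. (K has_real_derivative K' x) (at x)"
    and "\<And>x. (K' has_real_derivative K'' x) (at x)"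
    and "continuous_on UNIV K''"
    and "bounded (range K')" and "bounded (range K'')"
    and "\<And>\<phi>. \<phi> \<in> {0..\<Phi>\<^sub>F} \<Longrightarrow> K \<phi> > 0"
    and "\<And>\<phi>. \<phi> \<in> {0..\<Phi>\<^sub>F} \<Longrightarrow> K' \<phi> \<le> 0"
    and "\<And>\<eta>. \<eta> \<in> {0..1} \<Longrightarrow> (Q\<^sub>i has_real_derivative Q\<^sub>i' \<eta>) (at \<eta> within {0..1})"
    and "continuous_on {0..1} Q\<^sub>i'"
    and "mono_on {0..1} Q\<^sub>i"
    and "Q\<^sub>i 0 = 0" and "Q\<^sub>i 1 = \<Phi>\<^sub>F"
    and "Q\<^sub>i' 1 > K \<Phi>\<^sub>F"
    and "Q\<^sub>i' 1 - Q\<^sub>i' 0 = K \<Phi>\<^sub>F - K 0"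
    and "\<And>\<eta>. \<eta> \<in> {0..1} \<Longrightarrow> H_init K Q\<^sub>i Q\<^sub>i' \<eta> > 0"
  shows "\<exists>Q N.
      classical_solution K \<Phi>\<^sub>F Q\<^sub>i \<infinity> Q N \<and>
      (\<forall>P M. classical_solution K \<Phi>\<^sub>F Q\<^sub>i \<infinity> P M \<longrightarrow>
         (\<forall>\<tau>\<ge>0. M \<tau> = N \<tau> \<and> (\<forall>\<eta>\<in>{0..1}. P \<tau> \<eta> = Q \<tau> \<eta>))) \<and>
      0 < 1 / (GREATEST h. h \<in> H_init K Q\<^sub>i Q\<^sub>i' ` {0..1}) \<and>
      0 < (LEAST h. h \<in> H_init K Q\<^sub>i Q\<^sub>i' ` {0..1}) \<and>
      (\<forall>\<tau>\<ge>0. 1 / (GREATEST h. h \<in> H_init K Q\<^sub>i Q\<^sub>i' ` {0..1}) \<le> N \<tau> \<and>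
             N \<tau> \<le> 1 / (LEAST h. h \<in> H_init K Q\<^sub>i Q\<^sub>i' ` {0..1}))"
proof -
  note \<Phi> = assms(1) and K = assms(2) and K' = assms(3) and K'_bdd = assms(5) and K''_bdd = assms(6)
    and K_pos = assms(7) and K'_nonpos = assms(8) and Qi_deriv = assms(9) and Qi'_cont = assms(10)
    and Qi_mono = assms(11) and Qi_0 = assms(12) and Qi_1 = assms(13) and compat = assms(15)
    and H_pos = assms(16)
  let ?H = "H_init K Q\<^sub>i Q\<^sub>i'"
  obtain L1 L2 where L12: "\<And>x. \<bar>K' x\<bar> \<le> L1" "\<And>x. \<bar>K'' x\<bar> \<le> L2"
    using K'_bdd K''_bdd by (auto simp: bounded_iff)
  define L where "L = max L1 L2"
  have L: "\<bar>K' x\<bar> \<le> L" "\<bar>K'' x\<bar> \<le> L" for x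
    using L12[of x] by (auto simp: L_def)
  have K_cont: "continuous_on UNIV K" and K'_cont: "continuous_on UNIV K'"
    using K K' by (meson DERIV_continuous_on has_field_derivative_at_within)+
  have Qi_cont: "continuous_on {0..1} Q\<^sub>i"
    using Qi_deriv by (meson DERIV_continuous_on)
  have Qi_range: "Q\<^sub>i \<eta> \<in> {0..\<Phi>\<^sub>F}" if "\<eta> \<in> {0..1}" for \<eta>
    using mono_onD[OF Qi_mono, of 0 \<eta>] mono_onD[OF Qi_mono, of \<eta> 1] that Qi_0 Qi_1 by simp
  have H_cont: "continuous_on {0..1} ?H"
    unfolding H_init_def
    by (intro continuous_intros Qi'_cont continuous_on_compose2[OF K_cont Qi_cont]) auto
  obtain x1 where x1: "x1 \<in> {0..1}" "\<And>x. x \<in> {0..1} \<Longrightarrow> ?H x \<le> ?H x1"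
    using continuous_attains_sup[OF compact_Icc _ H_cont] by auto
  obtain x0 where x0: "x0 \<in> {0..1}" "\<And>x. x \<in> {0..1} \<Longrightarrow> ?H x0 \<le> ?H x"
    using continuous_attains_inf[OF compact_Icc _ H_cont] by auto
  have Max: "(GREATEST h. h \<in> ?H ` {0..1}) = ?H x1"
    by (rule Greatest_equality) (use x1 in auto)
  have Min: "(LEAST h. h \<in> ?H ` {0..1}) = ?H x0"
    by (rule Least_equality) (use x0 in auto)
  obtain F f where F: "\<And>x. (F has_real_derivative f x) (at x)" "\<And>x. \<bar>f x\<bar> \<le> L"
    "\<And>x z. \<bar>f x - f z\<bar> \<le> L * \<bar>x - z\<bar>" "\<And>x. f x \<le> 0" and FK: "\<And>x. x \<in> {0..\<Phi>\<^sub>F} \<Longrightarrow> F x = K x"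
    using monotone_extension[OF less_imp_le[OF \<Phi>] K K' L K'_nonpos] by metis
  interpret periodic_transport F f Q\<^sub>i Q\<^sub>i' \<Phi>\<^sub>F L "?H x0" "?H x1"
  proof
    show "0 < F x" if "x \<in> {0..\<Phi>\<^sub>F}" for x using FK[OF that] K_pos[OF that] by simp
    show "Q\<^sub>i' 1 - F \<Phi>\<^sub>F = Q\<^sub>i' 0 - F 0" using compat FK \<Phi> by simp
    show "0 < ?H x0" using H_pos x0(1) by simp
    show "Q\<^sub>i' \<eta> - F (Q\<^sub>i \<eta>) \<in> {?H x0..?H x1}" if "\<eta> \<in> {0..1}" for \<eta>
      using x0(2)[OF that] x1(2)[OF that] FK[OF Qi_range[OF that]] by (simp add: H_init_def)
  qed (use F Qi_deriv Qi'_cont Qi_mono Qi_0 Qi_1 in auto)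
  obtain u where "continuous_on UNIV u" "\<forall>x\<in>strip. u x = step u x"
    using fixed_point_exists by blast
  then interpret sol: periodic_transport_solution F f Q\<^sub>i Q\<^sub>i' \<Phi>\<^sub>F L "?H x0" "?H x1" u
    by unfold_locales auto
  let ?N = "\<lambda>\<tau>. 1 / sol.h \<tau>"
  have sol: "classical_solution K \<Phi>\<^sub>F Q\<^sub>i \<infinity> sol.Q ?N"
    by (rule sol.classical_solution_Q) (simp add: FK)
  have unique: "M \<tau> = ?N \<tau> \<and> (\<forall>\<eta>\<in>{0..1}. P \<tau> \<eta> = sol.Q \<tau> \<eta>)"
    if "classical_solution K \<Phi>\<^sub>F Q\<^sub>i \<infinity> P M" "0 \<le> \<tau>" for P M \<tau>
  proof -
    note char = classical_solution_characteristics[OF K K'_cont Qi_0 Qi_1]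
    note u = firing_characteristics_unique[OF K K'_cont L(1) char[OF that(1)] char[OF sol] that(2)]
    show ?thesis using arg_cong[OF u(1), of "\<lambda>z. 1 / z"] u(2) by simp
  qed
  have pos: "0 < ?H x0" "0 < ?H x1" using H_pos x0(1) x1(1) by auto
  have bounds: "1 / ?H x1 \<le> ?N \<tau> \<and> ?N \<tau> \<le> 1 / ?H x0" if "0 \<le> \<tau>" for \<tau>
    using sol.h_range[of \<tau>] sol.h_pos[OF that] pos that by (auto intro!: divide_left_mono)
  show ?thesis
    unfolding Max Min
  proof (intro exI[of _ sol.Q] exI[of _ ?N] conjI)
    show "\<forall>P M. classical_solution K \<Phi>\<^sub>F Q\<^sub>i \<infinity> P M \<longrightarrow>
        (\<forall>\<tau>\<ge>0. M \<tau> = ?N \<tau> \<and> (\<forall>\<eta>\<in>{0..1}. P \<tau> \<eta> = sol.Q \<tau> \<eta>))"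
      using unique by blast
    show "\<forall>\<tau>\<ge>0. 1 / ?H x1 \<le> ?N \<tau> \<and> ?N \<tau> \<le> 1 / ?H x0"
      using bounds by blast
  qed (use sol pos in simp_all)
qed

end
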